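(* Let $n\ge 1$ be an integer, let $\mathcal{P}$ be a finite $2$-group of maximal class, and let $\mathcal{G}$ be a finite nilpotent group of odd order having no cyclic Sylow subgroups, where $\gcd(n,|\mathcal{G}|)=\gcd(n,2)=1$. Let $G=\mathbb{Z}_n\times\mathcal{P}\times\mathcal{G}$. Then the non-cyclic graph $\Gamma(G)$ is Hamiltonian.
   Context: For a finite non-cyclic group $G$, $\mathrm{Cyc}(G)=\{x\in G:\langle x,y\rangle\text{ is cyclic for all }y\in G\}$. The non-cyclic graph $\Gamma(G)$ is the simple undirected graph with vertex set $G\setminus\mathrm{Cyc}(G)$ in which two distinct vertices $x,y$ are adjacent if and only if the subgroup $\langle x,y\rangle$ is not cyclic. A graph is Hamiltonian if it contains a cycle passing through all its vertices. "$\mathcal{G}$ has no cyclic Sylow subgroups" means that for every prime $p$ dividing $|\mathcal{G}|$ the Sylow $p$-subgroup of $\mathcal{G}$ is non-cyclic; the trivial group is allowed as $\mathcal{G}$. A non-cyclic $2$-group $H$ of order $2^m$ ($m\ge 2$) is of maximal class if $H^{(m-1)}\ne\{e\}$ and $H^{(m)}=\{e\}$, where $H^{(1)}=H$, $H^{(i+1)}=[H^{(i)},H]$ is the lower central series. These are exactly the groups $\mathcal{D}_{2^{t+1}}=\langle a,b: a^{2^t}=b^2=1,\ b^{-1}ab=a^{-1}\rangle$ ($t\ge1$), $\mathcal{Q}_{2^{t+1}}=\langle a,b: a^{2^t}=1,\ a^{2^{t-1}}=b^2,\ b^{-1}ab=a^{-1}\rangle$ ($t\ge2$), and $\mathcal{SD}_{2^{t+1}}=\langle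 a,b: a^{2^t}=b^2=1,\ b^{-1}ab=a^{-1+2^{t-1}}\rangle$ ($t\ge3$). *)

theory Defs
  imports "HOL-Algebra.Algebra" "Graph_Theory.Graph_Theory"
begin

section \<open>The non-cyclic graph of a group\<close>

definition Cyc :: "('a, 'b) monoid_scheme \<Rightarrow> 'a set" where
  "Cyc G = {x \<in> carrier G. \<forall>y \<in> carrier G. cyclic_group (subgroup_generated G {x, y})}"

text \<open>A simple undirected graph is represented, as in the graph library, by a loop-free
  symmetric digraph without parallel arcs.\<close>

definition non_cyclic_graph :: "('a, 'b) monoid_scheme \<Rightarrow> 'a pair_pre_digraph" where
  "non_cyclic_graph G =
    \<lparr> pverts = carrier G - Cyc G,
      parcs = {(x, y). x \<in> carrier G - Cyc G \<and> y \<in> carrier G - Cyc G \<and> x \<noteq> y \<and>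
                 \<not> cyclic_group (subgroup_generated G {x, y})} \<rparr>"

lemma pair_graph_non_cyclic_graph:
  assumes "finite (carrier G)"
  shows "pair_graph (non_cyclic_graph G)"
proof -
  let ?V = "carrier G - Cyc G"
  have "parcs (non_cyclic_graph G) \<subseteq> ?V \<times> ?V"
    by (auto simp: non_cyclic_graph_def)
  then have fin: "finite (parcs (non_cyclic_graph G))"
    using assms by (meson finite_Diff finite_SigmaI finite_subset)
  show ?thesis
  proof
    show "finite (parcs (non_cyclic_graph G))" by (rule fin)
    show "symmetric (with_proj (non_cyclic_graph G))"
      by (auto simp: symmetric_conv non_cyclic_graph_def insert_commute)
  qed (use assms in \<open>auto simp: non_cyclic_graph_def\<close>)
qed

text \<open>The library's cycles are directed, so in a symmetric digraph they include the closed walk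
  along a single edge and back. The bound on the length excludes it: a cycle of an
  undirected simple graph has at least three vertices.\<close>

definition hamiltonian :: "('a, 'b) pre_digraph \<Rightarrow> bool" where
  "hamiltonian \<Gamma> \<longleftrightarrow>
    (\<exists>p. pre_digraph.cycle \<Gamma> p \<and> 3 \<le> length p \<and> tail \<Gamma> ` set p = verts \<Gamma>)"

section \<open>Lower central series, nilpotency and maximal class\<close>

definition commutator_subgroup :: "('a, 'b) monoid_scheme \<Rightarrow> 'a set \<Rightarrow> 'a set \<Rightarrow> 'a set" where
  "commutator_subgroup G H K =
    generate G {h \<otimes>\<^bsub>G\<^esub> k \<otimes>\<^bsub>G\<^esub> inv\<^bsub>G\<^esub> h \<otimes>\<^bsub>G\<^esub> inv\<^bsub>G\<^esub> k | h k. h \<in> H \<and> k \<in> K}"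

text \<open>Indexed from 1: the term at 1 is the whole group, and the one at \<open>i + 1\<close> is the
  commutator subgroup of the one at \<open>i\<close> with the whole group. The value at 0 is not
  meaningful.\<close>

definition lower_central :: "('a, 'b) monoid_scheme \<Rightarrow> nat \<Rightarrow> 'a set" where
  "lower_central G i = ((\<lambda>H. commutator_subgroup G H (carrier G)) ^^ (i - 1)) (carrier G)"

lemma lower_central_1: "lower_central G 1 = carrier G"
  by (simp add: lower_central_def)

lemma lower_central_Suc:
  "1 \<le> i \<Longrightarrow> lower_central G (Suc i) = commutator_subgroup G (lower_central G i) (carrier G)"
  by (cases i) (simp_all add: lower_central_def)

definition nilpotent_group :: "('a, 'b) monoid_scheme \<Rightarrow> bool" where
  "nilpotent_group G \<longleftrightarrow> group G \<and> (\<exists>i \<ge> 1. lower_central G i = {\<one>\<^bsub>G\<^esub>})"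

definition maximal_class_2_group :: "('a, 'b) monoid_scheme \<Rightarrow> bool" where
  "maximal_class_2_group P \<longleftrightarrow> group P \<and> \<not> cyclic_group P \<and>
    (\<exists>m \<ge> 2. order P = 2 ^ m \<and>
       lower_central P (m - 1) \<noteq> {\<one>\<^bsub>P\<^esub>} \<and> lower_central P m = {\<one>\<^bsub>P\<^esub>})"

section \<open>Sylow subgroups\<close>

definition sylow_subgroup :: "nat \<Rightarrow> 'a set \<Rightarrow> ('a, 'b) monoid_scheme \<Rightarrow> bool" where
  "sylow_subgroup p S G \<longleftrightarrow> subgroup S G \<and> card S = p ^ multiplicity p (order G)"

definition no_cyclic_sylow :: "('a, 'b) monoid_scheme \<Rightarrow> bool" where
  "no_cyclic_sylow G \<longleftrightarrow>
    (\<forall>p S. Factorial_Ring.prime p \<longrightarrow> p dvd order G \<longrightarrow> sylow_subgroup p S G \<longrightarrow>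
       \<not> cyclic_group (subgroup_generated G S))"

end

theory Submission
  imports Defs "HOL-Number_Theory.Residues"
begin

text \<open>Write the vertices as triples \<open>(s, p, h)\<close>. By coprimality two of them are adjacent iff their
  second or their third components do not lie in a common cyclic subgroup. The noncentral \<open>p\<close> in
  \<open>P\<close> (the nontrivial ones if \<open>|P| = 4\<close>) form a set \<open>D\<close>; such a \<open>p\<close> is in no cyclic subgroup with
  at least half of \<open>P\<close>, so the vertices over \<open>D\<close> have degree at least half the number of vertices.
  A 2-group of maximal class has a center of order at most 2 unless it has order 4, so the
  complement \<open>B\<close> of \<open>D\<close> satisfies \<open>2 |B| < |D|\<close>.

  In \<open>H\<close> there is a map \<open>f\<close> on the nontrivial elements, at most two-to-one, such that
  \<open>\<langle>h, f h\<rangle>\<close> is never cyclic: every noncyclic Sylow subgroup contains two subgroups of order \<open>p\<close>,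
  and elements of coprime order commute, so these assemble to two elements \<open>w\<close>, \<open>w'\<close> such that
  \<open>f h = h w\<close> or \<open>f h = h w'\<close> works. All vertices \<open>(s, p, h)\<close> with \<open>p\<close> in \<open>B\<close> and \<open>f h = k\<close> are
  adjacent to the larger set \<open>{s} \<times> D \<times> {k}\<close>, and can be threaded into a path through it. Joining
  these paths end to end gives a cyclic arrangement of all vertices in which nonadjacent neighbors
  have large degree, and the reversals from Palmer's proof of Ore's theorem make it a cycle.\<close>

section \<open>Closing a path system to a Hamiltonian cycle\<close>

definition path_set :: "('a \<Rightarrow> 'a \<Rightarrow> bool) \<Rightarrow> 'a set \<Rightarrow> 'a set \<Rightarrow> bool" where
  "path_set R D U \<longleftrightarrow> (\<exists>xs. set xs = U \<and> distinct xs \<and> successively R xs \<and>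
     (xs \<noteq> [] \<longrightarrow> hd xs \<in> D \<and> last xs \<in> D))"

lemma path_set_Un:
  assumes "path_set R D U" "path_set R D W" "U \<inter> W = {}"
    and D: "\<And>x y. x \<in> D \<Longrightarrow> y \<in> D \<Longrightarrow> R x y"
  shows "path_set R D (U \<union> W)"
proof -
  obtain xs where xs: "set xs = U" "distinct xs" "successively R xs"
    "xs \<noteq> [] \<longrightarrow> hd xs \<in> D \<and> last xs \<in> D" using assms(1) by (auto simp: path_set_def)
  obtain ys where ys: "set ys = W" "distinct ys" "successively R ys"
    "ys \<noteq> [] \<longrightarrow> hd ys \<in> D \<and> last ys \<in> D" using assms(2) by (auto simp: path_set_def)
  show ?thesis unfolding path_set_def
    by (rule exI[of _ "xs @ ys"])
       (use xs ys assms(3) D in \<open>auto simp: successively_append_iff hd_append last_append\<close>)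
qed

lemma path_set_UN:
  assumes "finite I" "\<And>i. i \<in> I \<Longrightarrow> path_set R D (U i)"
    and "\<And>i j. i \<in> I \<Longrightarrow> j \<in> I \<Longrightarrow> i \<noteq> j \<Longrightarrow> U i \<inter> U j = {}"
    and D: "\<And>x y. x \<in> D \<Longrightarrow> y \<in> D \<Longrightarrow> R x y"
  shows "path_set R D (\<Union>i\<in>I. U i)"
  using assms(1-3)
proof (induction I rule: finite_induct)
  case empty
  show ?case by (simp add: path_set_def)
next
  case (insert i I)
  have "path_set R D (U i \<union> (\<Union>i\<in>I. U i))"
  proof (rule path_set_Un)
    show "U i \<inter> (\<Union>i\<in>I. U i) = {}" using insert.prems(2) insert.hyps by fastforce
  qed (use insert D in auto)
  then show ?case by simp
qed

text \<open>The path alternates between \<open>A\<close> and \<open>B\<close> until \<open>B\<close>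
  is exhausted and then runs through the rest of \<open>A\<close>. As \<open>A\<close> is strictly
  larger, the path also ends in \<open>A\<close>.\<close>

lemma path_set_Un_bad:
  assumes "finite A" "finite B" "card B < card A" "A \<subseteq> D" "A \<inter> B = {}"
    and D: "\<And>x y. x \<in> D \<Longrightarrow> y \<in> D \<Longrightarrow> R x y"
    and AB: "\<And>x y. x \<in> A \<Longrightarrow> y \<in> B \<Longrightarrow> R x y \<and> R y x"
  shows "path_set R D (A \<union> B)"
proof -
  \<comment> \<open>The induction needs the ends in \<open>A\<close> rather than merely in
    \<open>D\<close>: a new \<open>b\<close> is put in front of a head in \<open>A\<close>.\<close>
  have "\<exists>xs. set xs = A \<union> B \<and> distinct xs \<and> successively R xs \<and> xs \<noteq> [] \<and> hd xs \<in> A \<and> last xs \<in> A"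
    using assms(2,1,3-5) AB
  proof (induction B arbitrary: A rule: finite_induct)
    case empty
    then obtain xs where xs: "set xs = A" "distinct xs" using finite_distinct_list by blast
    moreover have "xs \<noteq> []" using xs empty by auto
    moreover have "successively R xs"
      using xs(1) empty.prems(3) D by (auto simp: successively_conv_nth subset_iff)
    ultimately show ?case by (intro exI[of _ xs]) auto
  next
    case (insert b B)
    have "A \<noteq> {}" using insert.prems by auto
    then obtain a where a: "a \<in> A" by blast
    have "\<exists>xs. set xs = (A - {a}) \<union> B \<and> distinct xs \<and> successively R xs \<and> xs \<noteq> [] \<and> hd xs \<in> A - {a} \<and> last xs \<in> A - {a}"
      by (rule insert.IH) (use insert.prems insert.hyps a in \<open>auto\<close>)
    then obtain xs where "set xs = (A - {a}) \<union> B" "distinct xs" "successively R xs" "xs \<noteq> []"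
      "hd xs \<in> A - {a}" "last xs \<in> A - {a}" by blast
    then show ?case
      by (intro exI[of _ "a # b # xs"])
         (use insert.prems insert.hyps a in \<open>auto simp: successively_Cons\<close>)
  qed
  then show ?thesis using assms(4) unfolding path_set_def by blast
qed

section \<open>Gaps in a cyclic arrangement and the reversal argument\<close>

definition gaps :: "('a \<Rightarrow> 'a \<Rightarrow> bool) \<Rightarrow> 'a list \<Rightarrow> nat" where
  "gaps E xs = length (filter (\<lambda>(x, y). \<not> E x y) (zip xs (tl xs)))"

lemma gaps_Nil [simp]: "gaps E [] = 0" and gaps_single [simp]: "gaps E [x] = 0"
  and gaps_Cons_Cons [simp]: "gaps E (x # y # xs) = of_bool (\<not> E x y) + gaps E (y # xs)"
  by (simp_all add: gaps_def)

lemma gaps_append: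
  assumes "xs \<noteq> []" "ys \<noteq> []"
  shows "gaps E (xs @ ys) = gaps E xs + gaps E ys + of_bool (\<not> E (last xs) (hd ys))"
  using assms
proof (induction xs rule: induct_list012)
  case (2 x)
  then show ?case by (cases ys) auto
qed auto

lemma gaps_rev:
  assumes "\<And>x y. E x y \<longleftrightarrow> E y x"
  shows "gaps E (rev xs) = gaps E xs"
proof (induction xs rule: induct_list012)
  case (3 x y zs)
  then show ?case using assms by (simp add: gaps_append[of "rev zs @ [y]" "[x]", simplified])
qed auto

lemma gaps_eq_0_iff: "gaps E xs = 0 \<longleftrightarrow> successively E xs"
  by (induction xs rule: induct_list012) auto

lemma gaps_pos_split:
  "gaps E xs > 0 \<Longrightarrow> \<exists>ys zs. xs = ys @ zs \<and> ys \<noteq> [] \<and> zs \<noteq> [] \<and> \<not> E (last ys) (hd zs)"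
proof (induction xs rule: induct_list012)
  case (3 x y zs)
  show ?case
  proof (cases "E x y")
    case True
    then obtain us vs where "y # zs = us @ vs" "us \<noteq> []" "vs \<noteq> []" "\<not> E (last us) (hd vs)"
      using 3 by auto
    then show ?thesis by (intro exI[of _ "x # us"] exI[of _ vs]) auto
  next
    case False
    then show ?thesis by (intro exI[of _ "[x]"] exI[of _ "y # zs"]) auto
  qed
qed auto

text \<open>The induction measure of the reversal argument. Counting the closing pair as well makes
  it invariant under rotation.\<close>

definition cycle_gaps :: "('a \<Rightarrow> 'a \<Rightarrow> bool) \<Rightarrow> 'a list \<Rightarrow> nat" where
  "cycle_gaps E xs = gaps E xs + of_bool (\<not> E (last xs) (hd xs))"

lemma cycle_gaps_commute: "ys \<noteq> [] \<Longrightarrow> zs \<noteq> [] \<Longrightarrow> cycle_gaps E (ys @ zs) = cycle_gaps E (zs @ ys)"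
  by (simp add: cycle_gaps_def gaps_append)

text \<open>The Ore--Palmer argument: a gap lies between two vertices of \<open>D\<close>, whose degrees add up to
  at least the number of vertices, so reversing a suitable final segment of the cyclic list closes
  this gap without opening one between vertices outside \<open>D\<close>.\<close>

lemma hamilton_cycle_closure:
  assumes "finite V"
    and sym: "\<And>x y. E x y \<longleftrightarrow> E y x" and irrefl: "\<And>x. \<not> E x x"
    and deg: "\<And>x. x \<in> D \<Longrightarrow> card V \<le> 2 * card {y \<in> V. E x y}"
    and "set xs = V" "distinct xs" "xs \<noteq> []"
    and "successively (\<lambda>x y. E x y \<or> x \<in> D \<and> y \<in> D) xs"
    and "E (last xs) (hd xs) \<or> last xs \<in> D \<and> hd xs \<in> D"
  shows "\<exists>ys. set ys = V \<and> distinct ys \<and> ys \<noteq> [] \<and> successively E ys \<and> E (last ys) (hd ys)"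
  using assms(5-)
proof (induction "cycle_gaps E xs" arbitrary: xs rule: less_induct)
  case less
  let ?R = "\<lambda>x y. E x y \<or> x \<in> D \<and> y \<in> D"
  have symR: "?R x y \<longleftrightarrow> ?R y x" for x y using sym by blast
  show ?case
  proof (cases "cycle_gaps E xs = 0")
    case True
    then show ?thesis using less.prems
      by (intro exI[of _ xs]) (auto simp: cycle_gaps_def gaps_eq_0_iff)
  next
    case False
    \<comment> \<open>Rotating the list moves some gap to the closing pair; by \<open>?R\<close>
      both of its ends are in \<open>D\<close>.\<close>
    have "\<exists>us. set us = V \<and> distinct us \<and> us \<noteq> [] \<and> successively ?R us \<and> ?R (last us) (hd us)
       \<and> \<not> E (last us) (hd us) \<and> cycle_gaps E us = cycle_gaps E xs"
    proof (cases "E (last xs) (hd xs)")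
      case True
      then have "gaps E xs > 0" using False by (simp add: cycle_gaps_def)
      then obtain ys zs where s: "xs = ys @ zs" "ys \<noteq> []" "zs \<noteq> []" "\<not> E (last ys) (hd zs)"
        using gaps_pos_split by blast
      show ?thesis
        by (intro exI[of _ "zs @ ys"])
           (use s less.prems in \<open>auto simp: successively_append_iff cycle_gaps_commute\<close>)
    next
      case False
      then show ?thesis using less.prems by blast
    qed
    then obtain us where us: "set us = V" "distinct us" "us \<noteq> []" "successively ?R us"
      "?R (last us) (hd us)" "\<not> E (last us) (hd us)" "cycle_gaps E us = cycle_gaps E xs" by blast
    define N where "N = length us"
    define l where "l = last us"
    define h where "h = hd us"
    have lh: "l \<in> D" "h \<in> D" "\<not> E l h" using us by (auto simp: l_def h_def)
    have N: "card V = N" "N > 0" using us by (auto simp: N_def distinct_card)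
    have hn: "h = us ! 0" "l = us ! (N - 1)" using us by (auto simp: h_def l_def hd_conv_nth last_conv_nth N_def)
    \<comment> \<open>A common element \<open>i\<close> is a position where the list can be cut
      between \<open>us ! i\<close> and \<open>us ! Suc i\<close>. Only \<open>N - 1\<close>
      positions occur, while the degrees of \<open>l\<close> and \<open>h\<close> add up to at least
      \<open>N\<close>. The omitted index costs no neighbor, since neither vertex is adjacent to
      itself.\<close>
    define A where "A = {i. i < N - 1 \<and> E l (us ! i)}"
    define B where "B = {i. i < N - 1 \<and> E h (us ! Suc i)}"
    have "{y \<in> V. E l y} \<subseteq> (!) us ` A"
    proof
      fix y assume y: "y \<in> {y \<in> V. E l y}"
      then obtain i where i: "i < N" "us ! i = y" using us by (auto simp: in_set_conv_nth N_def)
      have "i \<noteq> N - 1" using i y hn irrefl by (metis (mono_tags) mem_Collect_eq)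
      then show "y \<in> (!) us ` A" using i y by (auto simp: A_def)
    qed
    then have a: "card {y \<in> V. E l y} \<le> card A" by (rule surj_card_le[rotated]) (simp add: A_def)
    have "{y \<in> V. E h y} \<subseteq> (\<lambda>i. us ! Suc i) ` B"
    proof
      fix y assume y: "y \<in> {y \<in> V. E h y}"
      then obtain i where i: "i < N" "us ! i = y" using us by (auto simp: in_set_conv_nth N_def)
      have "i \<noteq> 0" using i y hn irrefl by (metis (mono_tags) mem_Collect_eq)
      then obtain j where "i = Suc j" by (cases i) auto
      then show "y \<in> (\<lambda>i. us ! Suc i) ` B" using i y by (auto simp: B_def)
    qed
    then have b: "card {y \<in> V. E h y} \<le> card B" by (rule surj_card_le[rotated]) (simp add: B_def)
    have "A \<inter> B \<noteq> {}"
    proof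
      assume "A \<inter> B = {}"
      then have "card A + card B = card (A \<union> B)" by (subst card_Un_disjoint) (auto simp: A_def B_def)
      also have "\<dots> \<le> card {..<N - 1}" by (rule card_mono) (auto simp: A_def B_def)
      finally have "card A + card B \<le> N - 1" by simp
      then show False using a b deg[OF lh(1)] deg[OF lh(2)] N by linarith
    qed
    then obtain i where i: "i < N - 1" "E l (us ! i)" "E h (us ! Suc i)" by (auto simp: A_def B_def)
    define ys where "ys = take (Suc i) us"
    define zs where "zs = drop (Suc i) us"
    have "us = ys @ zs" by (simp add: ys_def zs_def)
    moreover have "hd ys = h" using us(3) by (simp add: ys_def h_def)
    moreover have "last ys = us ! i" using i by (simp add: ys_def N_def take_Suc_conv_app_nth)
    moreover have "ys \<noteq> []" "zs \<noteq> []" "last zs = l" "hd zs = us ! Suc i"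
      using i us(3) by (auto simp: ys_def zs_def l_def N_def hd_drop_conv_nth)
    ultimately have yz: "us = ys @ zs" "ys \<noteq> []" "zs \<noteq> []" "hd ys = h" "last zs = l"
      "last ys = us ! i" "hd zs = us ! Suc i" by blast+
    \<comment> \<open>Reversing \<open>zs\<close> replaces the pair at the cut and the closing pair
      by two edges. The closing pair was a gap, and the pairs inside \<open>zs\<close> keep their
      status by symmetry, so the measure drops.\<close>
    show ?thesis
    proof (rule less.hyps[of "ys @ rev zs"])
      have e: "E (last ys) (hd (rev zs))" using i(2) sym[of l] yz by (simp add: hd_rev)
      have e': "E (last (ys @ rev zs)) (hd (ys @ rev zs))" using i(3) sym[of h] yz by (simp add: last_rev)
      show "cycle_gaps E (ys @ rev zs) < cycle_gaps E xs"
        unfolding us(7)[symmetric] using us(6) yz(1-3) e e'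
        by (simp add: cycle_gaps_def gaps_append gaps_rev[of E, OF sym])
      show "set (ys @ rev zs) = V" "distinct (ys @ rev zs)" "ys @ rev zs \<noteq> []" using yz us by auto
      have "successively ?R ys" "successively ?R zs" using us(4) yz by (simp_all add: successively_append_iff)
      moreover have "successively ?R (rev zs)" unfolding successively_rev
        using \<open>successively ?R zs\<close> by (rule successively_mono) (use symR in blast)
      ultimately show "successively ?R (ys @ rev zs)" using e
        by (simp add: successively_append_iff)
      show "?R (last (ys @ rev zs)) (hd (ys @ rev zs))" using e' by blast
    qed
  qed
qed

section \<open>From cyclic lists of vertices to cycles of arcs\<close>

lemma pcas_zip: "xs \<noteq> [] \<Longrightarrow> pcas (hd xs) (zip xs (tl xs @ [v])) v"
  by (induction xs rule: induct_list012) auto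

lemma hamiltonianI:
  assumes "set xs = pverts \<Gamma>" "distinct xs" "3 \<le> length xs"
    and "successively (\<lambda>x y. (x, y) \<in> parcs \<Gamma>) xs" "(last xs, hd xs) \<in> parcs \<Gamma>"
  shows "hamiltonian (with_proj \<Gamma>)"
proof -
  interpret pre_digraph "with_proj \<Gamma>" .
  \<comment> \<open>Each vertex is paired with its cyclic successor, so the tails of the arcs are
    exactly \<open>xs\<close>.\<close>
  define p where "p = zip xs (tl xs @ [hd xs])"
  have ne: "xs \<noteq> []" using assms by auto
  have len: "length p = length xs" using ne by (simp add: p_def)
  have snd: "map snd p = tl xs @ [hd xs]" and fst: "map fst p = xs" using ne by (simp_all add: p_def)
  have pne: "p \<noteq> []" using len ne by auto
  have cas: "cas (hd xs) p (hd xs)" unfolding cas_with_proj_eq p_def by (rule pcas_zip[OF ne])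
  have "set p \<subseteq> parcs \<Gamma>"
  proof
    fix e assume "e \<in> set p"
    then obtain i where i: "i < length xs" "e = (xs ! i, (tl xs @ [hd xs]) ! i)"
      using ne by (auto simp: p_def set_zip)
    show "e \<in> parcs \<Gamma>"
    proof (cases "Suc i < length xs")
      case True
      then show ?thesis using i assms(4) by (auto simp: nth_append nth_tl successively_conv_nth)
    next
      case False
      then have "i = length xs - 1" using i by auto
      then show ?thesis using i assms(5) ne by (auto simp: nth_append last_conv_nth)
    qed
  qed
  then have "awalk (hd xs) p (hd xs)" using cas ne assms(1) by (auto simp: awalk_def)
  moreover have "distinct (tl (awalk_verts (hd xs) p))"
    using awalk_verts_conv'[OF cas] pne snd assms(2) ne by (simp add: distinct_tl) (cases xs; auto)
  ultimately have "cycle p" using pne by (auto simp: cycle_def)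
  moreover have "fst ` set p = pverts \<Gamma>" using fst assms(1) by (metis list.set_map)
  ultimately show ?thesis using assms(3) len unfolding hamiltonian_def by (intro exI[of _ p]) auto
qed

section \<open>Pairs in a common cyclic subgroup\<close>

text \<open>Naming one element of which both are powers makes the notion easy to handle
  componentwise in direct products. Natural exponents suffice because the groups of interest are
  finite.\<close>

definition cyclic_pair :: "('a, 'b) monoid_scheme \<Rightarrow> 'a \<Rightarrow> 'a \<Rightarrow> bool" where
  "cyclic_pair G x y \<longleftrightarrow> (\<exists>z \<in> carrier G. \<exists>(i::nat) (j::nat). x = z [^]\<^bsub>G\<^esub> i \<and> y = z [^]\<^bsub>G\<^esub> j)"

lemma cyclic_pair_sym: "cyclic_pair G x y \<Longrightarrow> cyclic_pair G y x"
  unfolding cyclic_pair_def by blast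

context group
begin

lemma inv_cancel_left [simp]: "x \<in> carrier G \<Longrightarrow> y \<in> carrier G \<Longrightarrow> inv x \<otimes> (x \<otimes> y) = y"
  and cancel_inv_left [simp]: "x \<in> carrier G \<Longrightarrow> y \<in> carrier G \<Longrightarrow> x \<otimes> (inv x \<otimes> y) = y"
  by (simp_all flip: m_assoc)

lemma cyclic_pair_one: "x \<in> carrier G \<Longrightarrow> cyclic_pair G \<one> x"
  unfolding cyclic_pair_def by (metis nat_pow_0 nat_pow_eone)

lemma cyclic_pair_refl: "x \<in> carrier G \<Longrightarrow> cyclic_pair G x x"
  unfolding cyclic_pair_def by (rule bexI[of _ x], intro exI[of _ "1::nat"]) simp_all

lemma cyclic_pair_commute:
  "cyclic_pair G x y \<Longrightarrow> x \<otimes> y = y \<otimes> x"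
  unfolding cyclic_pair_def using nat_pow_comm by auto

lemma cyclic_group_subgroup_generated_iff:
  assumes fin: "finite (carrier G)" and x: "x \<in> carrier G" and y: "y \<in> carrier G"
  shows "cyclic_group (subgroup_generated G {x, y}) \<longleftrightarrow> cyclic_pair G x y"
proof
  let ?K = "subgroup_generated G {x, y}"
  assume "cyclic_group ?K"
  then obtain z where z: "z \<in> carrier ?K" "carrier ?K = range (\<lambda>n::int. z [^]\<^bsub>?K\<^esub> n)"
    using group.cyclic_group[OF group_subgroup_generated] by metis
  have zG: "z \<in> carrier G" using z(1) carrier_subgroup_generated_subset by blast
  have eq: "z [^]\<^bsub>?K\<^esub> (n::int) = z [^] n" for n using z(1) by (simp add: int_pow_subgroup_generated)
  have "{x, y} \<subseteq> carrier ?K" using x y by (intro subgroup_generated_subset_carrier_subset) auto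
  then have "x \<in> generate G {z}" "y \<in> generate G {z}"
    using z(2) eq generate_pow[OF zG] by auto
  then show "cyclic_pair G x y"
    unfolding cyclic_pair_def generate_pow_on_finite_carrier[OF fin zG] using zG by blast
next
  assume "cyclic_pair G x y"
  then obtain z and i j :: nat where z: "z \<in> carrier G" "x = z [^] i" "y = z [^] j"
    unfolding cyclic_pair_def by blast
  \<comment> \<open>\<open>z\<close> may generate more than \<open>x\<close> and \<open>y\<close>
    do; the gcd of the exponents picks a generator of the right subgroup, by Bezout.\<close>
  define w where "w = z [^] gcd i j"
  have w: "w \<in> carrier G" using z by (simp add: w_def)
  have "x = w [^] (i div gcd i j)" "y = w [^] (j div gcd i j)"
    using z by (simp_all add: w_def nat_pow_pow)
  then have xy: "{x, y} \<subseteq> generate G {w}"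
    unfolding generate_pow_on_finite_carrier[OF fin w] by blast
  obtain u v :: int where uv: "u * int i + v * int j = gcd (int i) (int j)" using bezout_int by blast
  have pw: "(z [^] k) [^] l = z [^] (l * int k)" for k :: nat and l :: int
  proof -
    have "(z [^] int k) [^] l = z [^] (int k * l)" using z(1) by (rule int_pow_pow)
    then show ?thesis by (simp only: int_pow_int mult.commute)
  qed
  have "w = z [^] int (gcd i j)" by (simp only: w_def int_pow_int)
  also have "int (gcd i j) = u * int i + v * int j" using uv by simp
  also have "z [^] (u * int i + v * int j) = x [^] u \<otimes> y [^] v"
    unfolding z(2,3) pw using z(1) by (rule int_pow_mult)
  also have "\<dots> \<in> generate G {x, y}"
  proof -
    have "subgroup (generate G {x, y}) G" using x y by (intro generate_is_subgroup) auto
    moreover have "x \<in> generate G {x, y}" "y \<in> generate G {x, y}" by (auto intro: generate.incl)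
    ultimately show ?thesis by (metis subgroup.m_closed subgroup_int_pow_closed)
  qed
  finally have "generate G {w} \<subseteq> generate G {x, y}"
    by (intro generate_subgroup_incl generate_is_subgroup) (use x y in auto)
  moreover have "generate G {x, y} \<subseteq> generate G {w}"
    by (intro generate_subgroup_incl generate_is_subgroup xy) (use w in auto)
  ultimately have "subgroup_generated G {x, y} = subgroup_generated G {w}"
    using x y w by (simp add: subgroup_generated_def)
  then show "cyclic_group (subgroup_generated G {x, y})" using cyclic_group_generated by simp
qed

lemma pow_cong:
  assumes x: "x \<in> carrier G" "x [^] (n::nat) = \<one>" and "[i = j] (mod n)"
  shows "x [^] (i::nat) = x [^] j"
proof -
  have "x [^] k = x [^] (k mod n)" for k :: nat
  proof -
    have "x [^] (n * (k div n) + k mod n) = (x [^] n) [^] (k div n) \<otimes> x [^] (k mod n)"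
      using x(1) by (simp only: nat_pow_mult nat_pow_pow nat_pow_closed)
    also have "\<dots> = x [^] (k mod n)" using x by (simp only: nat_pow_one nat_pow_closed l_one)
    finally show ?thesis by (simp only: mult_div_mod_eq)
  qed
  then show ?thesis using assms(3) unfolding cong_def by metis
qed

lemma pow_cong_order:
  assumes "x \<in> carrier G" "[i = j] (mod (order G))"
  shows "x [^] (i::nat) = x [^] j"
  using pow_cong[OF assms(1) pow_order_eq_1[OF assms(1)] assms(2)] .

end

section \<open>Direct products of groups of coprime order\<close>

lemma pow_DirProd: "(x, y) [^]\<^bsub>G \<times>\<times> H\<^esub> (n::nat) = (x [^]\<^bsub>G\<^esub> n, y [^]\<^bsub>H\<^esub> n)"
  by (induction n) auto

lemma order_DirProd: "order (G \<times>\<times> H) = order G * order H"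
  by (simp add: order_def card_cartesian_product)

lemma cyclic_pair_DirProdD:
  assumes "cyclic_pair (G \<times>\<times> H) (x, y) (x', y')"
  shows "cyclic_pair G x x'" "cyclic_pair H y y'"
  using assms unfolding cyclic_pair_def by (auto simp: pow_DirProd)

text \<open>The pair of the two common roots is a common root: the Chinese remainder theorem merges
  the exponents required in the two factors.\<close>

lemma cyclic_pair_DirProdI:
  assumes "group G" "group H" "coprime (order G) (order H)"
    and "cyclic_pair G x x'" "cyclic_pair H y y'"
  shows "cyclic_pair (G \<times>\<times> H) (x, y) (x', y')"
proof -
  obtain z and i i' :: nat where z: "z \<in> carrier G" "x = z [^]\<^bsub>G\<^esub> i" "x' = z [^]\<^bsub>G\<^esub> i'"
    using assms(4) unfolding cyclic_pair_def by blast
  obtain w and j j' :: nat where w: "w \<in> carrier H" "y = w [^]\<^bsub>H\<^esub> j" "y' = w [^]\<^bsub>H\<^esub> j'"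
    using assms(5) unfolding cyclic_pair_def by blast
  have crt: "\<exists>k::nat. (z [^]\<^bsub>G\<^esub> i, w [^]\<^bsub>H\<^esub> j) = (z, w) [^]\<^bsub>G \<times>\<times> H\<^esub> k" for i j :: nat
  proof -
    obtain k where k: "[k = i] (mod (order G))" "[k = j] (mod (order H))"
      using binary_chinese_remainder_nat[OF assms(3), of i j] by blast
    have "z [^]\<^bsub>G\<^esub> k = z [^]\<^bsub>G\<^esub> i" "w [^]\<^bsub>H\<^esub> k = w [^]\<^bsub>H\<^esub> j"
      using group.pow_cong_order[OF assms(1) z(1) k(1)] group.pow_cong_order[OF assms(2) w(1) k(2)] .
    then show ?thesis by (intro exI[of _ k]) (simp add: pow_DirProd)
  qed
  obtain k k' :: nat where "(x, y) = (z, w) [^]\<^bsub>G \<times>\<times> H\<^esub> k" "(x', y') = (z, w) [^]\<^bsub>G \<times>\<times> H\<^esub> k'"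
    using crt[of i j] crt[of i' j'] unfolding z(2,3) w(2,3) by blast
  moreover have "(z, w) \<in> carrier (G \<times>\<times> H)" using z w by simp
  ultimately show ?thesis unfolding cyclic_pair_def by blast
qed

lemma cyclic_pair_integer_mod_group:
  assumes "n > 0" "x \<in> carrier (integer_mod_group n)" "y \<in> carrier (integer_mod_group n)"
  shows "cyclic_pair (integer_mod_group n) x y"
proof -
  \<comment> \<open>The generator is written \<open>1 mod int n\<close> because for
    \<open>n = 1\<close> it is 0.\<close>
  have "x = (1 mod int n) [^]\<^bsub>integer_mod_group n\<^esub> (nat x)"
    "y = (1 mod int n) [^]\<^bsub>integer_mod_group n\<^esub> (nat y)"
    using assms by (auto simp: carrier_integer_mod_group mod_mult_right_eq)
  moreover have "1 mod int n \<in> carrier (integer_mod_group n)"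
    using assms by (simp add: carrier_integer_mod_group)
  ultimately show ?thesis unfolding cyclic_pair_def by blast
qed

section \<open>The lower central series\<close>

context group
begin

lemma commutator_subgroup_normal:
  assumes "N \<lhd> G"
  shows "commutator_subgroup G N (carrier G) \<lhd> G"
  unfolding commutator_subgroup_def
proof (rule normal_generateI)
  let ?S = "{h \<otimes> k \<otimes> inv h \<otimes> inv k |h k. h \<in> N \<and> k \<in> carrier G}"
  interpret N: normal N G by (rule assms)
  show "?S \<subseteq> carrier G" by auto
  fix c g assume "c \<in> ?S" and g: "g \<in> carrier G"
  then obtain h k where hk: "h \<in> N" "k \<in> carrier G" "c = h \<otimes> k \<otimes> inv h \<otimes> inv k" by blast
  have "g \<otimes> c \<otimes> inv g = (g \<otimes> h \<otimes> inv g) \<otimes> (g \<otimes> k \<otimes> inv g) \<otimes> inv (g \<otimes> h \<otimes> inv g) \<otimes> inv (g \<otimes> k \<otimes> inv g)"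
    using hk g by (simp add: m_assoc inv_mult_group)
  moreover have "g \<otimes> h \<otimes> inv g \<in> N" using N.inv_op_closed2 g hk by blast
  ultimately show "g \<otimes> c \<otimes> inv g \<in> ?S" using g hk by blast
qed

lemma lower_central_normal: "lower_central G (Suc i) \<lhd> G"
proof (induction i)
  case 0
  have "carrier G \<lhd> G" by (simp add: normal_inv_iff subgroup_self)
  then show ?case by (simp add: lower_central_def)
next
  case (Suc i)
  then show ?case by (simp add: lower_central_Suc commutator_subgroup_normal)
qed

lemma commutator_in_lower_central:
  assumes "h \<in> lower_central G (Suc i)" "k \<in> carrier G"
  shows "h \<otimes> k \<otimes> inv h \<otimes> inv k \<in> lower_central G (Suc (Suc i))"
  using assms by (auto simp: lower_central_Suc commutator_subgroup_def intro!: generate.incl)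

lemma lower_central_subset:
  assumes N: "subgroup N G"
    and "\<And>h k. h \<in> lower_central G (Suc i) \<Longrightarrow> k \<in> carrier G \<Longrightarrow> h \<otimes> k \<otimes> inv h \<otimes> inv k \<in> N"
  shows "lower_central G (Suc (Suc i)) \<subseteq> N"
  unfolding lower_central_Suc[of "Suc i", simplified] commutator_subgroup_def
  using assms by (intro generate_subgroup_incl) auto

lemma lower_central_Suc_subset: "lower_central G (Suc (Suc i)) \<subseteq> lower_central G (Suc i)"
proof (rule lower_central_subset)
  interpret N: normal "lower_central G (Suc i)" G by (rule lower_central_normal)
  show "subgroup (lower_central G (Suc i)) G" by (rule N.subgroup_axioms)
  fix h k assume h: "h \<in> lower_central G (Suc i)" and k: "k \<in> carrier G"
  have "h \<otimes> (k \<otimes> inv h \<otimes> inv k) \<in> lower_central G (Suc i)"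
    using h k N.inv_op_closed2 by blast
  then show "h \<otimes> k \<otimes> inv h \<otimes> inv k \<in> lower_central G (Suc i)"
    using h k by (simp add: m_assoc)
qed

text \<open>For normal \<open>N\<close> this is the preimage of the centralizer of the image of
  \<open>A\<close> in the quotient by \<open>N\<close>. With trivial \<open>N\<close> it gives
  ordinary centralizers, and the center if \<open>A\<close> is the carrier.\<close>

definition centralizer_mod :: "'a set \<Rightarrow> 'a set \<Rightarrow> 'a set" where
  "centralizer_mod N A = {y \<in> carrier G. \<forall>g \<in> A. y \<otimes> g \<otimes> inv y \<otimes> inv g \<in> N}"

lemma subgroup_centralizer_mod:
  assumes "N \<lhd> G" "A \<subseteq> carrier G"
  shows "subgroup (centralizer_mod N A) G"
proof
  interpret N: normal N G by (rule assms)
  show "centralizer_mod N A \<subseteq> carrier G" by (auto simp: centralizer_mod_def)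
  show "\<one> \<in> centralizer_mod N A" using assms(2) by (auto simp: centralizer_mod_def subset_iff)
  fix x assume x: "x \<in> centralizer_mod N A"
  then have xG: "x \<in> carrier G" by (simp add: centralizer_mod_def)
  show "inv x \<in> centralizer_mod N A"
    unfolding centralizer_mod_def
  proof (intro CollectI conjI ballI)
    fix g assume g: "g \<in> A"
    then have gG: "g \<in> carrier G" using assms(2) by blast
    have "inv x \<otimes> inv (x \<otimes> g \<otimes> inv x \<otimes> inv g) \<otimes> x \<in> N"
      using x g by (intro N.inv_op_closed1[OF xG N.m_inv_closed]) (simp add: centralizer_mod_def)
    also have "inv x \<otimes> inv (x \<otimes> g \<otimes> inv x \<otimes> inv g) \<otimes> x = inv x \<otimes> g \<otimes> inv (inv x) \<otimes> inv g"
      using xG gG by (simp add: m_assoc inv_mult_group)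
    finally show "inv x \<otimes> g \<otimes> inv (inv x) \<otimes> inv g \<in> N" .
  qed (use xG in simp)
  fix y assume y: "y \<in> centralizer_mod N A"
  then have yG: "y \<in> carrier G" by (simp add: centralizer_mod_def)
  show "x \<otimes> y \<in> centralizer_mod N A"
    unfolding centralizer_mod_def
  proof (intro CollectI conjI ballI)
    fix g assume g: "g \<in> A"
    then have gG: "g \<in> carrier G" using assms(2) by blast
    \<comment> \<open>The identity [xy, g] = x [y, g] x^-1 [x, g] writes the new commutator as a
      product of two members of \<open>N\<close>.\<close>
    have "(x \<otimes> (y \<otimes> g \<otimes> inv y \<otimes> inv g) \<otimes> inv x) \<otimes> (x \<otimes> g \<otimes> inv x \<otimes> inv g) \<in> N"
    proof (rule N.m_closed)
      show "x \<otimes> (y \<otimes> g \<otimes> inv y \<otimes> inv g) \<otimes> inv x \<in> N"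
        using y g by (intro N.inv_op_closed2[OF xG]) (simp add: centralizer_mod_def)
      show "x \<otimes> g \<otimes> inv x \<otimes> inv g \<in> N" using x g by (simp add: centralizer_mod_def)
    qed
    also have "(x \<otimes> (y \<otimes> g \<otimes> inv y \<otimes> inv g) \<otimes> inv x) \<otimes> (x \<otimes> g \<otimes> inv x \<otimes> inv g)
        = x \<otimes> y \<otimes> g \<otimes> inv (x \<otimes> y) \<otimes> inv g"
      using xG yG gG by (simp add: m_assoc inv_mult_group)
    finally show "x \<otimes> y \<otimes> g \<otimes> inv (x \<otimes> y) \<otimes> inv g \<in> N" .
  qed (use xG yG in simp)
qed

lemma two_card_subgroup_le:
  assumes fin: "finite (carrier G)" and K: "subgroup K G" and L: "subgroup L G" and "K \<subset> L"
  shows "2 * card K \<le> card L"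
proof -
  interpret L: group "G\<lparr>carrier := L\<rparr>" using L by (rule subgroup_imp_group)
  have "subgroup K (G\<lparr>carrier := L\<rparr>)" using K L assms(4) by (simp add: subgroup_incl psubset_imp_subset)
  from L.lagrange[OF this] have "card L = card (rcosets\<^bsub>G\<lparr>carrier := L\<rparr>\<^esub> K) * card K"
    by (simp add: order_def)
  then have "card K dvd card L" by simp
  moreover have "card K < card L"
    using assms(4) L fin by (meson psubset_card_mono finite_subset subgroup.subset)
  ultimately obtain m where m: "card L = card K * m" by auto
  then have "m \<noteq> 0" "m \<noteq> 1" using \<open>card K < card L\<close> by auto
  then have "m \<ge> 2" by simp
  then have "card K * 2 \<le> card K * m" by (rule mult_le_mono2)
  then show ?thesis using m by simp
qed

section \<open>Elements of coprime order commute in a nilpotent group\<close>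

lemma nat_pow_commute:
  assumes "u \<in> carrier G" "v \<in> carrier G" "u \<otimes> v = v \<otimes> u"
  shows "u [^] (k::nat) \<otimes> v = v \<otimes> u [^] k"
proof (induction k)
  case (Suc k)
  have "u [^] Suc k \<otimes> v = u [^] k \<otimes> (u \<otimes> v)" using assms(1,2) by (simp add: m_assoc)
  also have "\<dots> = (u [^] k \<otimes> v) \<otimes> u" unfolding assms(3) using assms(1,2) by (simp add: m_assoc)
  also have "\<dots> = v \<otimes> u [^] Suc k" unfolding Suc using assms(1,2) by (simp add: m_assoc)
  finally show ?case .
qed (use assms in simp)

text \<open>Since \<open>c\<close> commutes with \<open>x\<close> and \<open>y\<close>, moving x^k
  past \<open>y\<close>, or \<open>x\<close> past y^k, costs a factor c^k. Hence c^m and c^n are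
  trivial, and by coprimality so is \<open>c\<close>.\<close>

lemma commutator_trivial_of_coprime:
  fixes m n :: nat
  assumes x: "x \<in> carrier G" and y: "y \<in> carrier G"
    and c: "c = x \<otimes> y \<otimes> inv x \<otimes> inv y"
    and cx: "c \<otimes> x = x \<otimes> c" and cy: "c \<otimes> y = y \<otimes> c"
    and "x [^] m = \<one>" "y [^] n = \<one>" "coprime m n"
  shows "c = \<one>"
proof -
  have cG: "c \<in> carrier G" using x y c by simp
  have xy: "x \<otimes> y = c \<otimes> y \<otimes> x" using x y by (simp add: c m_assoc)
  have "x [^] k \<otimes> y = c [^] k \<otimes> y \<otimes> x [^] k" for k :: nat
  proof (induction k)
    case (Suc k)
    have "x [^] Suc k \<otimes> y = x [^] k \<otimes> (x \<otimes> y)" using x y by (simp add: m_assoc)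
    also have "\<dots> = x [^] k \<otimes> (c \<otimes> y \<otimes> x)" using xy by simp
    also have "\<dots> = (x [^] k \<otimes> c) \<otimes> y \<otimes> x" using x y cG by (simp add: m_assoc)
    also have "x [^] k \<otimes> c = c \<otimes> x [^] k" by (rule nat_pow_commute[OF x cG cx[symmetric]])
    also have "(c \<otimes> x [^] k) \<otimes> y \<otimes> x = c \<otimes> (x [^] k \<otimes> y) \<otimes> x" using x y cG by (simp add: m_assoc)
    also have "\<dots> = c \<otimes> c [^] k \<otimes> y \<otimes> x [^] Suc k" unfolding Suc using x y cG by (simp add: m_assoc)
    also have "c \<otimes> c [^] k = c [^] Suc k" using nat_pow_commute[OF cG cG refl, of k] by simp
    finally show ?case .
  qed (use y in simp)
  from this[of m] have "y = c [^] m \<otimes> y" using assms(6) y cG by simp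
  then have cm: "c [^] m = \<one>" using y cG r_cancel_one'[OF y nat_pow_closed[OF cG]] by simp
  have "x \<otimes> y [^] k = c [^] k \<otimes> y [^] k \<otimes> x" for k :: nat
  proof (induction k)
    case (Suc k)
    have "x \<otimes> y [^] Suc k = (x \<otimes> y [^] k) \<otimes> y" using x y by (simp add: m_assoc)
    also have "\<dots> = c [^] k \<otimes> y [^] k \<otimes> (x \<otimes> y)" unfolding Suc using x y cG by (simp add: m_assoc)
    also have "\<dots> = c [^] k \<otimes> (y [^] k \<otimes> c) \<otimes> y \<otimes> x" unfolding xy using x y cG by (simp add: m_assoc)
    also have "y [^] k \<otimes> c = c \<otimes> y [^] k" by (rule nat_pow_commute[OF y cG cy[symmetric]])
    finally show ?case using x y cG by (simp add: m_assoc)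
  qed (use x in simp)
  from this[of n] have "x = c [^] n \<otimes> x" using assms(7) x cG by simp
  then have "c [^] n = \<one>" using x cG r_cancel_one'[OF x nat_pow_closed[OF cG]] by simp
  then have "ord c dvd m" "ord c dvd n" using cm pow_eq_id[OF cG] by auto
  then have "ord c = 1" using coprime_common_divisor_nat[OF assms(8)] by simp
  then show ?thesis using ord_eq_1 cG by blast
qed

text \<open>The commutator of \<open>x\<close> and \<open>y\<close> lies in every term of the
  series: if it lies in one, it is central modulo the next, and
  \<open>commutator_trivial_of_coprime\<close> makes it trivial there.\<close>

lemma nilpotent_coprime_commute:
  fixes m n :: nat
  assumes "lower_central G (Suc c) = {\<one>}"
    and x: "x \<in> carrier G" and y: "y \<in> carrier G"
    and "x [^] m = \<one>" "y [^] n = \<one>" "coprime m n"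
  shows "x \<otimes> y = y \<otimes> x"
proof -
  define d where "d = x \<otimes> y \<otimes> inv x \<otimes> inv y"
  have dG: "d \<in> carrier G" using x y by (simp add: d_def)
  have "d \<in> lower_central G (Suc i)" for i
  proof (induction i)
    case 0
    then show ?case using dG by (simp add: lower_central_def)
  next
    case (Suc i)
    let ?N = "lower_central G (Suc (Suc i))"
    interpret N: normal ?N G by (rule lower_central_normal)
    \<comment> \<open>The commutator is central modulo the next term of the series.\<close>
    define Q h where "Q = G Mod ?N" and "h = (\<lambda>a. ?N #> a)"
    have "Group.group Q" unfolding Q_def by (rule N.factorgroup_is_group)
    moreover have "h \<in> hom G Q" unfolding Q_def h_def by (rule N.r_coset_hom_Mod)
    ultimately interpret h: group_hom G Q h
      by (intro group_hom.intro group_hom_axioms.intro is_group)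
    have one: "h a = \<one>\<^bsub>Q\<^esub> \<longleftrightarrow> a \<in> ?N" if "a \<in> carrier G" for a
      using that coset_join1[OF _ that N.subgroup_axioms] coset_join2[OF that N.subgroup_axioms]
      by (auto simp: Q_def h_def)
    have comm: "h d \<otimes>\<^bsub>Q\<^esub> h a = h a \<otimes>\<^bsub>Q\<^esub> h d" if a: "a \<in> carrier G" for a
    proof -
      let ?e = "d \<otimes> a \<otimes> inv d \<otimes> inv a"
      have eG: "?e \<in> carrier G" using a dG by simp
      have "h ?e = \<one>\<^bsub>Q\<^esub>"
        using one[OF eG] commutator_in_lower_central[OF Suc a] by blast
      moreover have "d \<otimes> a = ?e \<otimes> (a \<otimes> d)" using a dG by (simp add: m_assoc)
      then have "h (d \<otimes> a) = h ?e \<otimes>\<^bsub>Q\<^esub> h (a \<otimes> d)"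
        using h.hom_mult[OF eG m_closed[OF a dG]] by (simp only:)
      ultimately have "h (d \<otimes> a) = h (a \<otimes> d)" using h.hom_closed[OF m_closed[OF a dG]]
        by (simp only: h.H.l_one)
      then show ?thesis by (simp only: h.hom_mult[OF a dG] h.hom_mult[OF dG a])
    qed
    have "h d = \<one>\<^bsub>Q\<^esub>"
    proof (rule h.H.commutator_trivial_of_coprime[of "h x" "h y" _ m n])
      show "h d = h x \<otimes>\<^bsub>Q\<^esub> h y \<otimes>\<^bsub>Q\<^esub> inv\<^bsub>Q\<^esub> h x \<otimes>\<^bsub>Q\<^esub> inv\<^bsub>Q\<^esub> h y"
        unfolding d_def using x y by simp
      show "h x [^]\<^bsub>Q\<^esub> m = \<one>\<^bsub>Q\<^esub>" "h y [^]\<^bsub>Q\<^esub> n = \<one>\<^bsub>Q\<^esub>"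
        using x y assms by (metis h.hom_nat_pow h.hom_one)+
      show "h d \<otimes>\<^bsub>Q\<^esub> h x = h x \<otimes>\<^bsub>Q\<^esub> h d" "h d \<otimes>\<^bsub>Q\<^esub> h y = h y \<otimes>\<^bsub>Q\<^esub> h d"
        using comm x y by blast+
    qed (use x y assms in auto)
    then show ?case using one dG by blast
  qed
  then have "d = \<one>" using assms(1) by blast
  then have "d \<otimes> (y \<otimes> x) = y \<otimes> x" using x y by simp
  moreover have "d \<otimes> (y \<otimes> x) = x \<otimes> y" using x y by (simp add: d_def m_assoc)
  ultimately show ?thesis by simp
qed

end

section \<open>Nilpotent groups of odd order\<close>

text \<open>Modulo p^2 the power r^j is 1 + j p c, so the sum is p plus p c times p (p - 1) / 2. For
  odd \<open>p\<close> that triangular number is a multiple of \<open>p\<close>, and the second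
  summand vanishes modulo p^2.\<close>

lemma sum_powers_cong_prime:
  fixes p r :: nat
  assumes "odd p" and r: "[int r = 1] (mod int p)"
  shows "\<exists>q::int. (\<Sum>j<p. int r ^ j) = int p * (1 + int p * q)"
proof -
  obtain c where c: "int r = 1 + int p * c"
    using r by (metis cong_iff_lin cong_sym mult.commute)
  obtain m where m: "p = 2 * m + 1" using \<open>odd p\<close> by (rule oddE)
  have pw: "[int r ^ j = 1 + int j * (int p * c)] (mod int p ^ 2)" for j
  proof (induction j)
    case (Suc j)
    have "[int r ^ j * int r = (1 + int j * (int p * c)) * (1 + int p * c)] (mod int p ^ 2)"
      using Suc c by (metis cong_scalar_right)
    also have "(1 + int j * (int p * c)) * (1 + int p * c)
        = 1 + int (Suc j) * (int p * c) + int p ^ 2 * (int j * c * c)"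
      by (simp add: algebra_simps power2_eq_square)
    also have "[\<dots> = 1 + int (Suc j) * (int p * c)] (mod int p ^ 2)"
      by (simp add: cong_def)
    finally show ?case by (simp add: mult.commute)
  qed simp
  have "[(\<Sum>j<p. int r ^ j) = (\<Sum>j<p. 1 + int j * (int p * c))] (mod int p ^ 2)"
    by (rule cong_sum) (rule pw)
  also have "(\<Sum>j<p. 1 + int j * (int p * c)) = int p + (\<Sum>j<p. int j) * (int p * c)"
    by (simp add: sum.distrib sum_distrib_right)
  also have "(\<Sum>j<p. int j) = int p * int m"
  proof -
    have "2 * (\<Sum>j<n. int j) = int n * (int n - 1)" for n
      by (induction n) (auto simp: algebra_simps)
    from this[of p] show ?thesis by (simp add: m)
  qed
  also have "[int p + int p * int m * (int p * c) = int p] (mod int p ^ 2)"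
  proof -
    have "int p + int p * int m * (int p * c) = int p + int p ^ 2 * (int m * c)"
      by (simp add: power2_eq_square)
    then show ?thesis by (simp only: cong_def mod_mult_self2)
  qed
  finally obtain q where "(\<Sum>j<p. int r ^ j) = int p + int p ^ 2 * q"
    by (metis cong_iff_lin cong_sym mult.commute)
  then have "(\<Sum>j<p. int r ^ j) = int p * (1 + int p * q)"
    by (simp add: algebra_simps power2_eq_square)
  then show ?thesis by blast
qed

context group
begin

lemma conj_nat_pow:
  assumes "a \<in> carrier G" "b \<in> carrier G"
  shows "b \<otimes> a [^] (k::nat) \<otimes> inv b = (b \<otimes> a \<otimes> inv b) [^] k"
proof (induction k)
  case (Suc k)
  have "b \<otimes> a [^] Suc k \<otimes> inv b = (b \<otimes> a [^] k \<otimes> inv b) \<otimes> (b \<otimes> a \<otimes> inv b)"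
    using assms by (simp add: m_assoc)
  then show ?case unfolding Suc by simp
qed (use assms in simp)

lemma conj_nat_pow_iterate:
  assumes "w \<in> carrier G" "b \<in> carrier G" "b \<otimes> w \<otimes> inv b = w [^] (r::nat)"
  shows "b [^] (n::nat) \<otimes> w \<otimes> inv (b [^] n) = w [^] (r ^ n)"
proof (induction n)
  case (Suc n)
  have "b [^] Suc n \<otimes> w \<otimes> inv (b [^] Suc n) = b [^] n \<otimes> (b \<otimes> w \<otimes> inv b) \<otimes> inv (b [^] n)"
    using assms(1,2) by (simp add: m_assoc inv_mult_group)
  also have "\<dots> = (w [^] (r ^ n)) [^] r"
    unfolding assms(3) using conj_nat_pow[OF assms(1) nat_pow_closed[OF assms(2)], of n r] Suc by simp
  also have "\<dots> = w [^] (r ^ Suc n)" using assms(1) by (simp add: nat_pow_pow mult.commute)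
  finally show ?case .
qed (use assms in simp)

text \<open>Collecting the factors \<open>w\<close> on the left moves each of them past some b^j,
  which raises it to the power r^j.\<close>

lemma mult_nat_pow_conj:
  assumes w: "w \<in> carrier G" and b: "b \<in> carrier G" and "b \<otimes> w \<otimes> inv b = w [^] (r::nat)"
  shows "(w \<otimes> b) [^] (n::nat) = w [^] (\<Sum>j<n. r ^ j) \<otimes> b [^] n"
proof (induction n)
  case (Suc n)
  have c: "b [^] n \<otimes> w = w [^] (r ^ n) \<otimes> b [^] n"
    using conj_nat_pow_iterate[OF assms, of n] w b
    by (metis inv_solve_right' m_closed nat_pow_closed)
  have "(w \<otimes> b) [^] Suc n = w [^] (\<Sum>j<n. r ^ j) \<otimes> (b [^] n \<otimes> w) \<otimes> b"
    using Suc w b by (simp add: m_assoc)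
  also have "\<dots> = (w [^] (\<Sum>j<n. r ^ j) \<otimes> w [^] (r ^ n)) \<otimes> (b [^] n \<otimes> b)"
    unfolding c using w b by (simp add: m_assoc)
  also have "\<dots> = w [^] (\<Sum>j<Suc n. r ^ j) \<otimes> b [^] Suc n"
    using w by (simp add: nat_pow_mult)
  finally show ?case .
qed simp

text \<open>A finite cyclic group has at most one subgroup of order \<open>p\<close>. If
  \<open>z\<close> has order p m, then \<open>x\<close> and \<open>y\<close> are powers of z^m, and
  the exponent for \<open>x\<close> is invertible modulo \<open>p\<close>.\<close>

lemma pow_in_cyclic_of_prime_order:
  fixes p :: nat
  assumes "Factorial_Ring.prime p" and z: "z \<in> carrier G" "ord z > 0"
    and "x = z [^] (i::nat)" "y = z [^] (j::nat)"
    and "x [^] p = \<one>" "y [^] p = \<one>" "x \<noteq> \<one>"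
  shows "\<exists>k::nat. y = x [^] k"
proof -
  have d: "ord z dvd i * p" "\<not> ord z dvd i" "ord z dvd j * p"
    using assms by (auto simp: nat_pow_pow pow_eq_id)
  have "p dvd ord z"
  proof (rule ccontr)
    assume "\<not> p dvd ord z"
    then have "coprime (ord z) p" using prime_imp_coprime[OF assms(1)] coprime_commute by blast
    then show False using d(1,2) by (simp add: coprime_dvd_mult_left_iff)
  qed
  then obtain m where m: "ord z = p * m" by blast
  have p0: "p > 0" using assms(1) by (simp add: prime_gt_0_nat)
  have "m dvd i" "m dvd j" using d(1,3) p0 unfolding m by (auto simp: mult.commute)
  then obtain i' j' where ij: "i = m * i'" "j = m * j'" by (auto elim!: dvdE)
  have "\<not> p dvd i'" using d(2) unfolding m ij by auto
  then have "coprime i' p" using prime_imp_coprime[OF assms(1)] coprime_commute by blast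
  then obtain k where k: "[i' * k = j'] (mod p)"
  proof -
    from \<open>coprime i' p\<close> obtain l where "[i' * l = Suc 0] (mod p)" using cong_solve_coprime_nat by blast
    then have "[i' * l * j' = Suc 0 * j'] (mod p)" by (rule cong_scalar_right)
    then show ?thesis using that[of "l * j'"] by (simp add: mult.assoc)
  qed
  have "x [^] k = z [^] (m * (i' * k))" using assms(4) z ij by (simp add: nat_pow_pow mult.assoc)
  also have "\<dots> = z [^] (m * j')"
  proof -
    have "[m * (i' * k) = m * j'] (mod (ord z))"
      using k unfolding m mult.commute[of p m] cong_def by (metis mult_mod_right)
    then show ?thesis using pow_cong[OF z(1) pow_ord_eq_1[OF z(1)]] by blast
  qed
  finally show ?thesis using assms(5) ij by metis
qed

text \<open>In a cyclic group containing \<open>h\<close> and \<open>w\<close>, the subgroup of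
  order \<open>p\<close> contains both \<open>u\<close> and a nontrivial power of \<open>h\<close>;
  likewise with \<open>w'\<close> and \<open>v\<close>. Having both would make \<open>v\<close> a
  power of \<open>u\<close>.\<close>

lemma not_cyclic_pair_of_two_subgroups:
  fixes p :: nat
  assumes fin: "finite (carrier G)" and p: "Factorial_Ring.prime p"
    and h: "h \<in> carrier G" "p dvd ord h"
    and "u \<in> carrier G" "u \<noteq> \<one>" "u [^] p = \<one>"
    and "v \<in> carrier G" "v \<noteq> \<one>" "v [^] p = \<one>" "\<And>k::nat. v \<noteq> u [^] k"
    and "u = w [^] (a::nat)" "v = w' [^] (b::nat)"
  shows "\<not> cyclic_pair G h w \<or> \<not> cyclic_pair G h w'"
proof (rule ccontr)
  assume "\<not> ?thesis"
  then have hw: "cyclic_pair G h w" "cyclic_pair G h w'" by auto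
  define h' where "h' = h [^] (ord h div p)"
  have h0: "ord h > 0" using ord_ge_1[OF fin h(1)] by simp
  have "\<not> ord h dvd ord h div p"
    using h0 h(2) prime_gt_1_nat[OF p] by (intro nat_dvd_not_less) (auto simp: dvd_div_eq_0_iff)
  then have h': "h' [^] p = \<one>" "h' \<noteq> \<one>" "h' \<in> carrier G"
    using h by (auto simp: h'_def nat_pow_pow pow_eq_id)
  obtain z i j where z: "z \<in> carrier G" "h = z [^] (i::nat)" "w = z [^] (j::nat)"
    using hw(1) unfolding cyclic_pair_def by blast
  have e: "h' = z [^] (i * (ord h div p))" "u = z [^] (j * a)"
    using z assms(12) by (simp_all add: h'_def nat_pow_pow)
  have "ord z > 0" using ord_ge_1[OF fin z(1)] by simp
  from pow_in_cyclic_of_prime_order[OF p z(1) this e(2,1) assms(7) h'(1) assms(6)]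
  obtain k where k: "h' = u [^] (k::nat)" by blast
  obtain z i j where z: "z \<in> carrier G" "h = z [^] (i::nat)" "w' = z [^] (j::nat)"
    using hw(2) unfolding cyclic_pair_def by blast
  have e: "h' = z [^] (i * (ord h div p))" "v = z [^] (j * b)"
    using z assms(13) by (simp_all add: h'_def nat_pow_pow)
  have "ord z > 0" using ord_ge_1[OF fin z(1)] by simp
  from pow_in_cyclic_of_prime_order[OF p z(1) this e h'(1) assms(10) h'(2)]
  obtain l where l: "v = h' [^] (l::nat)" by blast
  show False using assms(11)[of "k * l"] l k assms(5) by (simp add: nat_pow_pow)
qed

text \<open>The product of all \<open>u p\<close> works: the factors commute because of their
  coprime orders, and the Chinese remainder theorem provides exponents that isolate a single
  factor.\<close>

lemma common_root_of_prime_powers: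
  fixes A :: "nat set"
  assumes "finite A" "\<And>p. p \<in> A \<Longrightarrow> Factorial_Ring.prime p"
    and "\<And>p. p \<in> A \<Longrightarrow> u p \<in> carrier G \<and> u p [^] p = \<one>"
    and comm: "\<And>x y (m::nat) (n::nat). x \<in> carrier G \<Longrightarrow> y \<in> carrier G \<Longrightarrow> x [^] m = \<one> \<Longrightarrow> y [^] n = \<one> \<Longrightarrow>
      coprime m n \<Longrightarrow> x \<otimes> y = y \<otimes> x"
  shows "\<exists>w \<in> carrier G. w [^] (\<Prod>A) = \<one> \<and> (\<forall>p \<in> A. \<exists>k::nat. u p = w [^] k)"
  using assms(1-3)
proof (induction A rule: finite_induct)
  case empty
  show ?case by (intro bexI[of _ "\<one>"]) auto
next
  case (insert p A)
  then obtain w where w: "w \<in> carrier G" "w [^] (\<Prod>A) = \<one>" "\<forall>p \<in> A. \<exists>k::nat. u p = w [^] k"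
    by auto
  have up: "u p \<in> carrier G" "u p [^] p = \<one>" using insert.prems by auto
  have cop: "coprime (\<Prod>A) p"
    using insert.hyps insert.prems(1) by (intro prod_coprime_left) (metis insertI1 insertI2 primes_coprime)
  have c: "w \<otimes> u p = u p \<otimes> w" using comm[OF w(1) up(1) w(2) up(2) cop] .
  have pw: "(w \<otimes> u p) [^] k = w [^] k \<otimes> u p [^] k" for k :: nat
    using pow_mult_distrib[OF c w(1) up(1)] .
  have crt: "\<exists>k::nat. (w \<otimes> u p) [^] k = w [^] i \<otimes> u p [^] j" for i j :: nat
  proof -
    obtain k where "[k = i] (mod (\<Prod>A))" "[k = j] (mod p)"
      using binary_chinese_remainder_nat[OF cop] by blast
    then show ?thesis using pow_cong[OF w(1,2)] pow_cong[OF up] pw by metis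
  qed
  show ?case
  proof (intro bexI[of _ "w \<otimes> u p"] conjI ballI)
    have "w [^] (p * \<Prod>A) = (w [^] (\<Prod>A)) [^] p" by (subst nat_pow_pow[OF w(1)]) (simp only: mult.commute)
    moreover have "u p [^] (p * \<Prod>A) = (u p [^] p) [^] (\<Prod>A)" by (subst nat_pow_pow[OF up(1)]) (simp only:)
    ultimately show "(w \<otimes> u p) [^] (\<Prod>(insert p A)) = \<one>"
      using insert.hyps w up by (simp add: pw)
    fix q assume "q \<in> insert p A"
    show "\<exists>k::nat. u q = (w \<otimes> u p) [^] k"
    proof (cases "q = p")
      case True
      then show ?thesis using crt[of 0 1] up(1) by (metis l_one nat_pow_0 nat_pow_eone)
    next
      case False
      then obtain k where "u q = w [^] (k::nat)" using w(3) \<open>q \<in> insert p A\<close> by blast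
      then show ?thesis using crt[of k 0] w(1) by (metis r_one nat_pow_0 nat_pow_closed)
    qed
  qed (use w up in auto)
qed

end

section \<open>Two subgroups of order \<open>p\<close> in a non-cyclic
  \<open>p\<close>-subgroup\<close>

lemma ex_step_nat:
  assumes "\<not> Q (0::nat)" "Q n"
  shows "\<exists>i. \<not> Q i \<and> Q (Suc i)"
  using assms(2) by (induction n) (use assms(1) in blast)+

context group
begin

text \<open>Let \<open>a\<close> have maximal order in \<open>S\<close>, and let \<open>b\<close> in \<open>S\<close>, not in \<open>\<langle>a\<rangle>\<close>, normalize
  \<open>\<langle>a\<rangle>\<close> with \<open>b\<^sup>p\<close> in \<open>\<langle>a\<rangle>\<close>. By maximality \<open>b\<^sup>p\<close> is a \<open>p\<close>-th power of an element of
  \<open>\<langle>a\<rangle>\<close>, and as \<open>p\<close> is odd, some \<open>a\<^sup>i b\<close> has order \<open>p\<close>.\<close>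

lemma exists_two_subgroups_of_prime_order:
  fixes p :: nat
  assumes fin: "finite (carrier G)" and nil: "lower_central G (Suc c) = {\<one>}"
    and p: "Factorial_Ring.prime p" "odd p"
    and S: "subgroup S G" "card S = p ^ k"
    and nc: "\<And>a. a \<in> S \<Longrightarrow> generate G {a} \<noteq> S"
  shows "\<exists>u \<in> carrier G. \<exists>v \<in> carrier G. u \<noteq> \<one> \<and> v \<noteq> \<one> \<and> u [^] p = \<one> \<and> v [^] p = \<one> \<and> (\<forall>n::nat. v \<noteq> u [^] n)"
proof -
  interpret S: subgroup S G by (rule S(1))
  have finS: "finite S" using fin S.subset finite_subset by blast
  have powS: "x [^] (n::nat) \<in> S" if "x \<in> S" for x n
    using that by (induction n) auto
  have pk: "x [^] (p ^ k) = \<one>" if "x \<in> S" for x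
  proof -
    interpret K: group "G\<lparr>carrier := S\<rparr>" by (rule S.subgroup_is_group[OF is_group])
    have "x [^]\<^bsub>G\<lparr>carrier := S\<rparr>\<^esub> order (G\<lparr>carrier := S\<rparr>) = \<one>" using K.pow_order_eq_1[of x] that by simp
    then show ?thesis using S(2) by (simp add: order_def flip: nat_pow_consistent)
  qed
  have ordp: "\<exists>e. ord x = p ^ e" if "x \<in> S" for x
    using pk[OF that] that p(1) by (auto simp: pow_eq_id divides_primepow_nat)
  obtain a where a: "a \<in> S" "\<And>x. x \<in> S \<Longrightarrow> ord x \<le> ord a"
  proof -
    have "Max (ord ` S) \<in> ord ` S" by (rule Max_in) (use finS S.one_closed in blast)+
    then obtain a where "a \<in> S" "ord a = Max (ord ` S)" by force
    then show ?thesis using that finS by simp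
  qed
  have aG: "a \<in> carrier G" using a(1) by (rule S.mem_carrier)
  define A where "A = generate G {a}"
  have A: "A = range (\<lambda>n::nat. a [^] n)"
    unfolding A_def generate_pow_on_finite_carrier[OF fin aG] by auto
  have sA: "subgroup A G" unfolding A_def by (rule generate_is_subgroup) (use aG in simp)
  have "A \<subseteq> S" using A powS[OF a(1)] by auto
  moreover have "A \<noteq> S" unfolding A_def by (rule nc[OF a(1)])
  ultimately have nA: "\<not> S \<subseteq> A" by blast
  obtain e where e: "ord a = p ^ e" using ordp[OF a(1)] by blast
  have "e \<noteq> 0"
  proof
    assume "e = 0"
    have "x = \<one>" if "x \<in> S" for x
    proof -
      have xG: "x \<in> carrier G" using that by (rule S.mem_carrier)
      have "ord x = 1" using a(2)[OF that] ord_ge_1[OF fin xG] e \<open>e = 0\<close> by simp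
      then show ?thesis using ord_eq_1[OF xG] by blast
    qed
    then have "S \<subseteq> A" using subgroup.one_closed[OF sA] by blast
    then show False using nA by blast
  qed
  then obtain e' where e': "e = Suc e'" by (cases e) auto
  have p1: "p > 1" using p(1) by (rule prime_gt_1_nat)
  \<comment> \<open>This is the last term of the lower central series that meets \<open>S\<close>
    outside \<open>A\<close>. Commutators with \<open>a\<close> of its elements in \<open>S\<close>
    fall into the next term, hence into \<open>A\<close>, so these elements normalize
    \<open>A\<close>.\<close>
  obtain i where i: "\<not> lower_central G (Suc i) \<inter> S \<subseteq> A" "lower_central G (Suc (Suc i)) \<inter> S \<subseteq> A"
  proof -
    have "\<not> lower_central G (Suc 0) \<inter> S \<subseteq> A" using nA S.subset by (auto simp: lower_central_def)
    moreover have "lower_central G (Suc c) \<inter> S \<subseteq> A" using nil subgroup.one_closed[OF sA] by simp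
    ultimately show ?thesis
      using that ex_step_nat[of "\<lambda>i. lower_central G (Suc i) \<inter> S \<subseteq> A" c] by blast
  qed
  interpret N: normal "lower_central G (Suc i)" G by (rule lower_central_normal)
  obtain b0 where b0: "b0 \<in> lower_central G (Suc i)" "b0 \<in> S" "b0 \<notin> A" using i(1) by blast
  \<comment> \<open>The last of the iterated \<open>p\<close>-th powers of \<open>b0\<close> that is
    outside \<open>A\<close> serves as \<open>b\<close>; its own \<open>p\<close>-th power is in
    \<open>A\<close>.\<close>
  obtain j where j: "b0 [^] (p ^ j) \<notin> A" "b0 [^] (p ^ Suc j) \<in> A"
  proof -
    have "b0 [^] (p ^ 0) \<notin> A" using b0 by simp
    moreover have "b0 [^] (p ^ k) \<in> A" using pk[OF b0(2)] subgroup.one_closed[OF sA] by simp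
    ultimately show ?thesis using that ex_step_nat[of "\<lambda>j. b0 [^] (p ^ j) \<in> A" k] by blast
  qed
  define b where "b = b0 [^] (p ^ j)"
  have bS: "b \<in> S" unfolding b_def by (rule powS[OF b0(2)])
  then have bG: "b \<in> carrier G" by (rule S.mem_carrier)
  have bA: "b \<notin> A" using j(1) by (simp add: b_def)
  have bN: "b \<in> lower_central G (Suc i)"
  proof -
    have "b0 [^] (n::nat) \<in> lower_central G (Suc i)" for n
      using b0(1) by (induction n) auto
    then show ?thesis by (simp add: b_def)
  qed
  have "b [^] p = b0 [^] (p ^ Suc j)"
    unfolding b_def by (subst nat_pow_pow[OF subgroup.mem_carrier[OF S(1) b0(2)]]) (simp add: mult.commute)
  then obtain t where t: "b [^] p = a [^] (t::nat)" using j(2) A by auto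
  obtain r where r: "b \<otimes> a \<otimes> inv b = a [^] (r::nat)"
  proof -
    have "b \<otimes> a \<otimes> inv b \<otimes> inv a \<in> lower_central G (Suc (Suc i)) \<inter> S"
      using commutator_in_lower_central[OF bN aG] bS a(1) by auto
    then have "b \<otimes> a \<otimes> inv b \<otimes> inv a \<in> A" using i(2) by blast
    moreover have "a \<in> A" unfolding A_def by (auto intro: generate.incl)
    ultimately have "b \<otimes> a \<otimes> inv b \<otimes> inv a \<otimes> a \<in> A" by (rule subgroup.m_closed[OF sA])
    then have "b \<otimes> a \<otimes> inv b \<in> A" using aG bG by (simp add: m_assoc)
    then show ?thesis using that A by auto
  qed
  \<comment> \<open>Since b^p is in \<open>A\<close>, it commutes with \<open>a\<close>, so r^p is 1
    modulo \<open>ord a\<close>, a multiple of \<open>p\<close>. Fermat's theorem reduces r^p to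
    \<open>r\<close>.\<close>
  have r1: "[r = 1] (mod p)"
  proof -
    have "a [^] (r ^ p) = b [^] p \<otimes> a \<otimes> inv (b [^] p)"
      using conj_nat_pow_iterate[OF aG bG r] by simp
    also have "\<dots> = a"
      unfolding t using nat_pow_commute[OF aG aG refl, of t] aG by (simp add: m_assoc)
    finally have "a [^] int (r ^ p) = a [^] int 1" using aG by (simp only: int_pow_int nat_pow_eone)
    then have "int (ord a) dvd int 1 - int (r ^ p)" using int_pow_eq[OF aG] by blast
    moreover have "int p dvd int (ord a)" using e e' by simp
    ultimately have "[1 = r ^ p] (mod p)"
      by (metis cong_iff_dvd_diff cong_int_iff dvd_trans)
    moreover have "[r ^ p = r] (mod p)"
    proof (cases "p dvd r")
      case True
      moreover have "r dvd r ^ p" using p1 by (intro dvd_power) simp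
      ultimately have "p dvd r ^ p" by (rule dvd_trans)
      then show ?thesis using True by (simp add: cong_def dvd_eq_mod_eq_0)
    next
      case False
      have "[r ^ (p - 1) * r = 1 * r] (mod p)"
        by (rule cong_scalar_right) (rule fermat_theorem[OF p(1) False])
      moreover have "r ^ (p - 1) * r = r ^ p" using p1 by (cases p) simp_all
      ultimately show ?thesis by simp
    qed
    ultimately show ?thesis by (metis cong_sym cong_trans)
  qed
  \<comment> \<open>Otherwise b^p has the same order as \<open>a\<close>, and the order of
    \<open>b\<close> is \<open>p\<close> times as large, against the choice of
    \<open>a\<close>.\<close>
  have "p dvd t"
  proof (rule ccontr)
    assume "\<not> p dvd t"
    then have "coprime t (ord a)"
      unfolding e using prime_imp_coprime[OF p(1)] coprime_commute by (blast intro: coprime_power_right_iff[THEN iffD2])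
    then have o: "ord (b [^] p) = p ^ e" using pow_ord_eq_ord_iff[OF fin aG] e t by simp
    obtain f where f: "ord b = p ^ f" using ordp[OF bS] by blast
    have "f \<noteq> 0"
    proof
      assume "f = 0"
      then have "b = \<one>" using f ord_eq_1[OF bG] by simp
      then show False using bA subgroup.one_closed[OF sA] by blast
    qed
    then have "ord (b [^] p) = p ^ f div p" using ord_pow[OF bG, of p] f p1 by (simp add: dvd_power)
    then have "p ^ e * p = p ^ f" using o \<open>f \<noteq> 0\<close> by (metis dvd_div_mult_self dvd_power not_gr_zero)
    then have "ord b = ord a * p" using f e by simp
    then show False using a(2)[OF bS] p1 e by simp
  qed
  then obtain s where s: "t = p * s" by blast
  have "[int r = 1] (mod int p)" using r1 by (metis cong_int_iff of_nat_1)
  from sum_powers_cong_prime[OF p(2) this]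
  obtain q :: int where q: "(\<Sum>j<p. int r ^ j) = int p * (1 + int p * q)" by blast
  have "coprime (1 + int p * q) (int p)"
  proof (rule coprimeI)
    fix d assume "d dvd 1 + int p * q" "d dvd int p"
    then show "is_unit d" using dvd_add_left_iff[of d "int p * q" 1] by simp
  qed
  then have "coprime (1 + int p * q) (int p ^ e)" by simp
  then obtain x where x: "[(1 + int p * q) * x = 1] (mod int p ^ e)" using cong_solve_coprime_int by blast
  \<comment> \<open>The \<open>p\<close>-th power of a^i' b is \<open>a\<close> to the exponent i' p
    (1 + p q) + p s. It is trivial if i' (1 + p q) is -s modulo p^e, which is solved with the
    inverse \<open>x\<close> of 1 + p q.\<close>
  define i' where "i' = nat ((- int s * x) mod int p ^ e)"
  have "int i' = (- int s * x) mod int p ^ e" using p1 by (simp add: i'_def)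
  then have "[int i' * (1 + int p * q) = (- int s * x) * (1 + int p * q)] (mod int p ^ e)"
    by (intro cong_scalar_right) (simp add: cong_def)
  also have "(- int s * x) * (1 + int p * q) = - int s * ((1 + int p * q) * x)" by (simp add: algebra_simps)
  also have "[\<dots> = - int s * 1] (mod int p ^ e)" by (rule cong_scalar_left[OF x])
  finally have "int p ^ e dvd int i' * (1 + int p * q) + int s"
    by (simp add: cong_iff_dvd_diff)
  then have "int p ^ e dvd int p * (int i' * (1 + int p * q) + int s)" by (rule dvd_mult)
  also have "int p * (int i' * (1 + int p * q) + int s) = int (i' * (\<Sum>j<p. r ^ j) + t)"
    using q by (simp add: s algebra_simps)
  finally have z: "ord a dvd i' * (\<Sum>j<p. r ^ j) + t" unfolding e by (metis of_nat_dvd_iff of_nat_power)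
  define w where "w = a [^] i'"
  have wG: "w \<in> carrier G" using aG by (simp add: w_def)
  have wA: "w \<in> A" using A by (auto simp: w_def)
  have "b \<otimes> w \<otimes> inv b = (a [^] r) [^] i'" unfolding w_def conj_nat_pow[OF aG bG] r ..
  also have "\<dots> = w [^] r" using aG by (simp add: w_def nat_pow_pow mult.commute)
  finally have "(w \<otimes> b) [^] p = w [^] (\<Sum>j<p. r ^ j) \<otimes> b [^] p"
    by (rule mult_nat_pow_conj[OF wG bG])
  also have "\<dots> = a [^] (i' * (\<Sum>j<p. r ^ j) + t)"
    unfolding t w_def using aG by (simp add: nat_pow_pow nat_pow_mult)
  also have "\<dots> = \<one>" using z pow_eq_id[OF aG] by blast
  finally have vp: "(w \<otimes> b) [^] p = \<one>" .
  have vA: "w \<otimes> b \<notin> A"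
  proof
    assume "w \<otimes> b \<in> A"
    then have "inv w \<otimes> (w \<otimes> b) \<in> A" using wA sA by (meson subgroup.m_closed subgroup.m_inv_closed)
    then show False using bA wG bG by simp
  qed
  \<comment> \<open>\<open>u\<close> has order \<open>p\<close> in \<open>A\<close>; the other
    element \<open>w \<otimes> b\<close> is outside \<open>A\<close> and hence no power of
    \<open>u\<close>.\<close>
  define u where "u = a [^] (p ^ e')"
  have "u [^] p = \<one>" unfolding u_def using aG by (simp add: nat_pow_pow pow_eq_id e e' mult.commute)
  moreover have "u \<noteq> \<one>"
    unfolding u_def using aG p1 by (auto simp: pow_eq_id e e' dest: dvd_imp_le)
  moreover have "w \<otimes> b \<noteq> u [^] n" for n :: nat
    using vA aG unfolding A u_def by (auto simp: nat_pow_pow)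
  moreover have "w \<otimes> b \<noteq> \<one>" using vA subgroup.one_closed[OF sA] by auto
  ultimately show ?thesis using vp wG bG aG by (intro bexI[of _ u] bexI[of _ "w \<otimes> b"]) (auto simp: u_def)
qed

end

section \<open>The partner map on \<open>H\<close>\<close>

lemma (in group) cyclic_pair_mult_cancel:
  assumes fin: "finite (carrier G)"
    and hx: "cyclic_pair G h (h \<otimes> x)" "h \<in> carrier G" "x \<in> carrier G"
  shows "cyclic_pair G h x"
proof -
  obtain z and i j :: nat where z: "z \<in> carrier G" "h = z [^] i" "h \<otimes> x = z [^] j"
    using hx(1) unfolding cyclic_pair_def by blast
  \<comment> \<open>z^l is the inverse of \<open>h\<close>, expressed with a natural
    exponent.\<close>
  define l where "l = i * (ord z - 1)"
  have "ord z \<ge> 1" using ord_ge_1[OF fin z(1)] .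
  then have "i + l = ord z * i" by (cases "ord z") (simp_all add: l_def)
  then have "z [^] i \<otimes> z [^] l = \<one>" using z(1) by (simp add: nat_pow_mult pow_eq_id)
  then have "z [^] l = inv h" using z by (metis inv_char nat_pow_closed nat_pow_comm)
  moreover have "z [^] (l + j) = z [^] l \<otimes> z [^] j"
    using z(1) by (simp add: nat_pow_mult)
  ultimately have "z [^] (l + j) = inv h \<otimes> (h \<otimes> x)" by (simp only: z(3))
  also have "\<dots> = x" using hx by simp
  finally have "z [^] (l + j) = x" .
  then show ?thesis using z unfolding cyclic_pair_def by blast
qed

text \<open>Sending \<open>h\<close> to \<open>w\<close> or \<open>w'\<close> itself would give
  large fibers. Multiplying by \<open>h\<close> does not make the pair cyclic, and \<open>h\<close>
  is recovered from its image by dividing by \<open>w\<close> or by \<open>w'\<close>, so the fibers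
  have at most two elements.\<close>

lemma nilpotent_noncyclic_partner:
  assumes nil: "nilpotent_group H" and fin: "finite (carrier H)" and odd: "odd (order H)"
    and ncs: "no_cyclic_sylow H"
  shows "\<exists>f. (\<forall>h \<in> carrier H - {\<one>\<^bsub>H\<^esub>}. f h \<in> carrier H - {\<one>\<^bsub>H\<^esub>} \<and> \<not> cyclic_pair H h (f h)) \<and>
    (\<forall>k. card {h \<in> carrier H - {\<one>\<^bsub>H\<^esub>}. f h = k} \<le> 2)"
proof -
  interpret group H using nil by (simp add: nilpotent_group_def)
  obtain c0 where "c0 \<ge> 1" "lower_central H c0 = {\<one>\<^bsub>H\<^esub>}" using nil by (auto simp: nilpotent_group_def)
  then obtain c where c: "lower_central H (Suc c) = {\<one>\<^bsub>H\<^esub>}" by (cases c0) auto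
  have ordH: "order H > 0" using fin by (simp add: order_gt_0_iff_finite)
  define A where "A = prime_factors (order H)"
  have A: "finite A" "p \<in> A \<longleftrightarrow> Factorial_Ring.prime p \<and> p dvd order H" for p
    using ordH by (auto simp: A_def in_prime_factors_iff)
  define Q where "Q p u v \<longleftrightarrow> u \<in> carrier H \<and> v \<in> carrier H \<and> u \<noteq> \<one>\<^bsub>H\<^esub> \<and> v \<noteq> \<one>\<^bsub>H\<^esub>
      \<and> u [^]\<^bsub>H\<^esub> p = \<one>\<^bsub>H\<^esub> \<and> v [^]\<^bsub>H\<^esub> p = \<one>\<^bsub>H\<^esub> \<and> (\<forall>n::nat. v \<noteq> u [^]\<^bsub>H\<^esub> n)" for p :: nat and u v
  have "\<exists>u v. Q p u v" if "p \<in> A" for p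
  proof -
    have p: "Factorial_Ring.prime p" "p dvd order H" using that A by auto
    have "odd p" using p(2) odd by (meson dvd_trans)
    obtain m where "order H = p ^ multiplicity p (order H) * m" using multiplicity_dvd by (metis dvdE)
    then obtain S where S: "subgroup S H" "card S = p ^ multiplicity p (order H)"
      using sylow_thm[OF p(1) is_group _ fin] by blast
    then have "\<not> cyclic_group (subgroup_generated H S)"
      using ncs p by (auto simp: no_cyclic_sylow_def sylow_subgroup_def)
    moreover have "subgroup_generated H {a} = subgroup_generated H S" if "a \<in> S" "generate H {a} = S" for a
    proof -
      have "carrier H \<inter> {a} = {a}" using that(1) S(1) subgroup.subset by blast
      moreover have "generate H (carrier H \<inter> S) = S"
        using subgroup.carrier_subgroup_generated_subgroup[OF S(1)] by (simp only: carrier_subgroup_generated)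
      ultimately show ?thesis using that(2) by (simp add: subgroup_generated_def)
    qed
    ultimately have "generate H {a} \<noteq> S" if "a \<in> S" for a
      using that cyclic_group_generated[of a] by metis
    from exists_two_subgroups_of_prime_order[OF fin c p(1) \<open>odd p\<close> S this]
    show ?thesis unfolding Q_def by blast
  qed
  then obtain u v where "Q p (u p) (v p)" if "p \<in> A" for p by metis
  then have uv: "u p \<in> carrier H" "v p \<in> carrier H" "u p \<noteq> \<one>\<^bsub>H\<^esub>" "v p \<noteq> \<one>\<^bsub>H\<^esub>"
      "u p [^]\<^bsub>H\<^esub> p = \<one>\<^bsub>H\<^esub>" "v p [^]\<^bsub>H\<^esub> p = \<one>\<^bsub>H\<^esub>" "\<forall>n::nat. v p \<noteq> u p [^]\<^bsub>H\<^esub> n" if "p \<in> A" for p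
    using that unfolding Q_def by simp_all
  have pr: "Factorial_Ring.prime p" if "p \<in> A" for p using that A by blast
  obtain w where w: "w \<in> carrier H" "\<forall>p \<in> A. \<exists>k::nat. u p = w [^]\<^bsub>H\<^esub> k"
    using common_root_of_prime_powers[OF A(1) pr, of u] uv nilpotent_coprime_commute[OF c] by blast
  obtain w' where w': "w' \<in> carrier H" "\<forall>p \<in> A. \<exists>k::nat. v p = w' [^]\<^bsub>H\<^esub> k"
    using common_root_of_prime_powers[OF A(1) pr, of v] uv nilpotent_coprime_commute[OF c] by blast
  \<comment> \<open>Both \<open>w\<close> and \<open>w'\<close> have powers of every prime order dividing \<open>|H|\<close>, generating
    different subgroups, so a nontrivial \<open>h\<close> cannot be in a cyclic group with both.\<close>
  define f where "f h = h \<otimes>\<^bsub>H\<^esub> (if cyclic_pair H h w then w' else w)" for h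
  have key: "\<not> cyclic_pair H h (if cyclic_pair H h w then w' else w)" if h: "h \<in> carrier H" "h \<noteq> \<one>\<^bsub>H\<^esub>" for h
  proof -
    have "ord h \<noteq> 1" using h ord_eq_1 by blast
    then obtain p where p: "Factorial_Ring.prime p" "p dvd ord h" using prime_factor_nat by blast
    then have "p \<in> A" using A ord_dvd_group_order[OF h(1)] dvd_trans by blast
    then obtain i j where ij: "u p = w [^]\<^bsub>H\<^esub> (i::nat)" "v p = w' [^]\<^bsub>H\<^esub> (j::nat)" using w w' by blast
    have "\<not> cyclic_pair H h w \<or> \<not> cyclic_pair H h w'"
      using uv[OF \<open>p \<in> A\<close>] by (intro not_cyclic_pair_of_two_subgroups[OF fin p(1) h(1) p(2) _ _ _ _ _ _ _ ij]) auto
    then show ?thesis by auto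
  qed
  have wc: "(if cyclic_pair H h w then w' else w) \<in> carrier H" for h using w w' by simp
  have "f h \<in> carrier H - {\<one>\<^bsub>H\<^esub>} \<and> \<not> cyclic_pair H h (f h)" if "h \<in> carrier H - {\<one>\<^bsub>H\<^esub>}" for h
  proof -
    have h: "h \<in> carrier H" "h \<noteq> \<one>\<^bsub>H\<^esub>" using that by auto
    have nc: "\<not> cyclic_pair H h (f h)" using cyclic_pair_mult_cancel[OF fin _ h(1) wc] key[OF h] by (auto simp only: f_def)
    have "cyclic_pair H h \<one>\<^bsub>H\<^esub>" using cyclic_pair_sym[OF cyclic_pair_one[OF h(1)]] .
    then have "f h \<noteq> \<one>\<^bsub>H\<^esub>" using nc by metis
    moreover have "f h \<in> carrier H" unfolding f_def using h(1) wc by (rule m_closed)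
    ultimately show ?thesis using nc by blast
  qed
  moreover have "card {h \<in> carrier H - {\<one>\<^bsub>H\<^esub>}. f h = k} \<le> 2" for k
  proof -
    have "{h \<in> carrier H - {\<one>\<^bsub>H\<^esub>}. f h = k} \<subseteq> {k \<otimes>\<^bsub>H\<^esub> inv\<^bsub>H\<^esub> w, k \<otimes>\<^bsub>H\<^esub> inv\<^bsub>H\<^esub> w'}"
    proof
      fix h assume "h \<in> {h \<in> carrier H - {\<one>\<^bsub>H\<^esub>}. f h = k}"
      then have h: "h \<in> carrier H" "k = f h" by auto
      show "h \<in> {k \<otimes>\<^bsub>H\<^esub> inv\<^bsub>H\<^esub> w, k \<otimes>\<^bsub>H\<^esub> inv\<^bsub>H\<^esub> w'}"
        using w w' h(1) unfolding h(2) f_def by (simp add: m_assoc)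
    qed
    then have "card {h \<in> carrier H - {\<one>\<^bsub>H\<^esub>}. f h = k} \<le> card {k \<otimes>\<^bsub>H\<^esub> inv\<^bsub>H\<^esub> w, k \<otimes>\<^bsub>H\<^esub> inv\<^bsub>H\<^esub> w'}"
      by (intro card_mono) auto
    also have "\<dots> \<le> 2" by (rule order_trans[OF card_insert_le_m1]) auto
    finally show ?thesis .
  qed
  ultimately show ?thesis by blast
qed

section \<open>2-groups of maximal class\<close>

context group
begin

text \<open>Term i + 1 is always central modulo term i + 2. If the two centralizers were equal, it
  would be central modulo term i + 3, so term i + 2 would lie in term i + 3. The series would be
  constant from there on, making term n + 1 trivial.\<close>

lemma centralizer_mod_lower_central_strict:
  assumes "lower_central G (Suc (Suc n)) = {\<one>}" "lower_central G (Suc n) \<noteq> {\<one>}" "Suc i \<le> n"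
  shows "centralizer_mod (lower_central G (Suc (Suc (Suc i)))) (carrier G)
       \<subset> centralizer_mod (lower_central G (Suc (Suc i))) (carrier G)"
proof (rule psubsetI)
  show "centralizer_mod (lower_central G (Suc (Suc (Suc i)))) (carrier G)
       \<subseteq> centralizer_mod (lower_central G (Suc (Suc i))) (carrier G)"
    using lower_central_Suc_subset[of "Suc i"] by (auto simp: centralizer_mod_def)
  show "centralizer_mod (lower_central G (Suc (Suc (Suc i)))) (carrier G)
       \<noteq> centralizer_mod (lower_central G (Suc (Suc i))) (carrier G)"
  proof
    assume eq: "centralizer_mod (lower_central G (Suc (Suc (Suc i)))) (carrier G)
       = centralizer_mod (lower_central G (Suc (Suc i))) (carrier G)"
    have sub: "subgroup (lower_central G (Suc j)) G" for j
      using lower_central_normal normal_imp_subgroup by blast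
    have step: "lower_central G (Suc (Suc i)) \<subseteq> lower_central G (Suc (Suc (Suc i)))"
    proof (rule lower_central_subset[OF sub])
      fix h k assume h: "h \<in> lower_central G (Suc i)" and k: "k \<in> carrier G"
      have "h \<in> carrier G" using subgroup.mem_carrier[OF sub h] .
      then have "h \<in> centralizer_mod (lower_central G (Suc (Suc i))) (carrier G)"
        using commutator_in_lower_central[OF h] by (simp add: centralizer_mod_def)
      then have "h \<in> centralizer_mod (lower_central G (Suc (Suc (Suc i)))) (carrier G)" using eq by simp
      then show "h \<otimes> k \<otimes> inv h \<otimes> inv k \<in> lower_central G (Suc (Suc (Suc i)))"
        using k unfolding centralizer_mod_def by blast
    qed
    have up: "lower_central G (Suc (Suc i)) \<subseteq> lower_central G (Suc (Suc i + d))" for d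
    proof (induction d)
      case (Suc d)
      have "lower_central G (Suc (Suc (Suc i))) \<subseteq> lower_central G (Suc (Suc (Suc i + d)))"
        using Suc commutator_in_lower_central by (intro lower_central_subset[OF sub]) blast
      then show ?case using step by simp
    qed simp
    have down: "lower_central G (Suc (i' + d)) \<subseteq> lower_central G (Suc i')" for i' d
    proof (induction d)
      case (Suc d)
      then show ?case using lower_central_Suc_subset[of "i' + d"] by simp
    qed simp
    have "lower_central G (Suc (Suc i)) \<subseteq> {\<one>}"
      using up[of "n - i"] assms by simp
    moreover have "lower_central G (Suc n) \<subseteq> lower_central G (Suc (Suc i))"
      using down[of "Suc i" "n - Suc i"] assms(3) by simp
    ultimately show False using assms(2) subgroup.one_closed[OF sub, of n] by blast
  qed
qed

text \<open>The centralizers of the group modulo the terms of its lower central series decrease strictly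
  from the whole group to the center, and the first of these steps has index at least 4.\<close>

lemma card_center_maximal_class:
  assumes fin: "finite (carrier G)" and ord: "order G = 2 ^ (l + 3)"
    and "lower_central G (Suc (Suc (Suc l))) = {\<one>}" "lower_central G (Suc (Suc l)) \<noteq> {\<one>}"
  shows "card (centralizer_mod {\<one>} (carrier G)) \<le> 2"
proof -
  \<comment> \<open>\<open>K 0\<close> is the whole group, as all commutators lie in the second
    term, and \<open>K (Suc l)\<close> is the center, as term l + 3 is trivial.\<close>
  define K where "K i = centralizer_mod (lower_central G (Suc (Suc i))) (carrier G)" for i
  have sub: "subgroup (K i) G" for i
    unfolding K_def by (intro subgroup_centralizer_mod lower_central_normal subset_refl)
  have strict: "K (Suc i) \<subset> K i" if "i \<le> l" for i
    unfolding K_def using assms that by (intro centralizer_mod_lower_central_strict[of "Suc l"]) auto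
  have half: "2 * card (K (Suc i)) \<le> card (K i)" if "i \<le> l" for i
    by (rule two_card_subgroup_le[OF fin sub sub strict[OF that]])
  have chain: "card (K (Suc d)) * 2 ^ d \<le> card (K 1)" if "d \<le> l" for d
    using that
  proof (induction d)
    case (Suc d)
    have "card (K (Suc (Suc d))) * 2 ^ Suc d = (2 * card (K (Suc (Suc d)))) * 2 ^ d" by simp
    also have "\<dots> \<le> card (K (Suc d)) * 2 ^ d" using half[of "Suc d"] Suc.prems by (intro mult_le_mono1) simp
    also have "\<dots> \<le> card (K 1)" using Suc by simp
    finally show ?case .
  qed simp
  let ?N = "lower_central G (Suc (Suc (Suc 0)))"
  interpret N: normal ?N G by (rule lower_central_normal)
  have "K 1 \<subset> carrier G"
    using strict[of 0] subgroup.subset[OF sub[of 0]] by (simp add: psubset_subset_trans)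
  then obtain x where x: "x \<in> carrier G" "x \<notin> K 1" by blast
  \<comment> \<open>This group contains \<open>x\<close> and so exceeds \<open>K 1\<close>, but it
    is proper because \<open>x\<close> is not central modulo the third term. Being strictly in
    between, it makes the index of \<open>K 1\<close> at least 4.\<close>
  define L where "L = centralizer_mod ?N {x}"
  have sL: "subgroup L G" unfolding L_def using x by (intro subgroup_centralizer_mod lower_central_normal) simp
  have "x \<in> L" using x(1) by (simp add: L_def centralizer_mod_def m_assoc)
  moreover have "K 1 \<subseteq> L" using x(1) by (auto simp: K_def L_def centralizer_mod_def)
  ultimately have "2 * card (K 1) \<le> card L" using x(2) by (intro two_card_subgroup_le[OF fin sub sL]) blast
  moreover have "2 * card L \<le> card (carrier G)"
  proof (rule two_card_subgroup_le[OF fin sL subgroup_self])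
    obtain g where g: "g \<in> carrier G" "x \<otimes> g \<otimes> inv x \<otimes> inv g \<notin> ?N"
      using x by (auto simp: K_def centralizer_mod_def)
    have "g \<notin> L"
    proof
      assume "g \<in> L"
      then have "inv (g \<otimes> x \<otimes> inv g \<otimes> inv x) \<in> ?N" by (intro N.m_inv_closed) (simp add: L_def centralizer_mod_def)
      then show False using g x by (simp add: inv_mult_group m_assoc)
    qed
    then show "L \<subset> carrier G" using g(1) subgroup.subset[OF sL] by blast
  qed
  ultimately have "4 * card (K 1) \<le> 2 ^ (l + 3)" using ord by (simp add: order_def)
  \<comment> \<open>A factor 4 for the first step and a factor 2 for each of the \<open>l\<close>
    others leave at most 2 out of 2^(l + 3).\<close>
  then have "4 * (card (K (Suc l)) * 2 ^ l) \<le> 2 ^ (l + 3)" using chain[of l] by linarith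
  then have "card (K (Suc l)) \<le> 2" by (simp add: power_add)
  then show ?thesis using assms(3) by (simp add: K_def)
qed

section \<open>Elements of \<open>P\<close> outside a common cyclic subgroup\<close>

lemma card_not_cyclic_pair_ge:
  assumes fin: "finite (carrier G)" and L: "subgroup L G" "L \<subset> carrier G"
    and "\<And>q. q \<in> carrier G \<Longrightarrow> q \<notin> L \<Longrightarrow> \<not> cyclic_pair G p q"
  shows "order G \<le> 2 * card {q \<in> carrier G. \<not> cyclic_pair G p q}"
proof -
  have "2 * card L \<le> card (carrier G)" by (rule two_card_subgroup_le[OF fin L(1) subgroup_self L(2)])
  moreover have "card (carrier G - L) = card (carrier G) - card L"
    using L fin by (intro card_Diff_subset) (auto intro: finite_subset subgroup.subset)
  moreover have "card (carrier G - L) \<le> card {q \<in> carrier G. \<not> cyclic_pair G p q}"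
    using assms fin by (intro card_mono) auto
  ultimately show ?thesis by (simp add: order_def)
qed

lemma cyclic_group_of_ord_eq_order:
  assumes fin: "finite (carrier G)" and "a \<in> carrier G" "ord a = order G"
  shows "cyclic_group G"
proof -
  have "generate G {a} \<subseteq> carrier G" using assms(2) by (intro generate_incl) simp
  moreover have "card (generate G {a}) = card (carrier G)"
    using generate_pow_card[OF assms(2)] assms(3) by (simp add: order_def)
  ultimately have "carrier G = generate G {a}" using card_subset_eq[OF fin] by blast
  then show ?thesis unfolding cyclic_group using assms(2) generate_pow[OF assms(2)] by auto
qed

text \<open>All elements have order at most 2, so a cyclic subgroup containing the nontrivial
  \<open>p\<close> is generated by it.\<close>

lemma noncyclic_order_4_not_cyclic_pair:
  assumes fin: "finite (carrier G)" and "order G = 4" "\<not> cyclic_group G"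
    and p: "p \<in> carrier G" "p \<noteq> \<one>" and q: "q \<in> carrier G" "q \<notin> generate G {p}"
  shows "\<not> cyclic_pair G p q"
proof
  have ord2: "ord x \<le> 2" if "x \<in> carrier G" for x
  proof -
    have "ord x dvd 4" using ord_dvd_group_order[OF that] assms(2) by simp
    then have "ord x \<le> 4" "ord x \<noteq> 3" using dvd_imp_le by auto
    moreover have "ord x \<noteq> 4" using cyclic_group_of_ord_eq_order[OF fin that] assms(2,3) by auto
    ultimately show ?thesis by linarith
  qed
  assume "cyclic_pair G p q"
  then obtain z where z: "z \<in> carrier G" "p \<in> generate G {z}" "q \<in> generate G {z}"
    unfolding cyclic_pair_def using generate_pow_on_finite_carrier[OF fin] by blast
  have "generate G {p} \<subseteq> generate G {z}"
    using z by (intro generate_subgroup_incl generate_is_subgroup) auto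
  moreover have "ord p \<noteq> 1" "ord p \<ge> 1" using p ord_eq_1 ord_ge_1[OF fin] by blast+
  then have "card (generate G {z}) \<le> card (generate G {p})"
    using ord2[OF z(1)] generate_pow_card[OF z(1)] generate_pow_card[OF p(1)] by linarith
  moreover have "finite (generate G {z})" using fin generate_incl[of "{z}"] z(1) finite_subset by blast
  ultimately have "generate G {p} = generate G {z}" by (meson card_seteq)
  then show False using q z(3) by simp
qed

end

text \<open>\<open>B\<close> is the center, except in order 4, where the center is everything and
  \<open>B\<close> is trivial. At most one element \<open>z\<close> of \<open>B\<close> can fail to
  share a cyclic subgroup with some \<open>q\<close>; then \<open>q\<close> and the product of
  \<open>z\<close> and \<open>q\<close> are the two partners in \<open>D\<close>.\<close>

lemma maximal_class_2_group_decomposition: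
  assumes "maximal_class_2_group P"
  obtains D B z where "carrier P = D \<union> B" "D \<inter> B = {}" "\<one>\<^bsub>P\<^esub> \<in> B" "2 * card B < card D"
    "\<And>p. p \<in> D \<Longrightarrow> order P \<le> 2 * card {q \<in> carrier P. \<not> cyclic_pair P p q}"
    "\<And>b q. b \<in> B \<Longrightarrow> b \<noteq> z \<Longrightarrow> q \<in> carrier P \<Longrightarrow> cyclic_pair P b q"
    "\<And>q. z \<in> B \<Longrightarrow> q \<in> carrier P \<Longrightarrow> \<not> cyclic_pair P z q \<Longrightarrow>
      \<exists>d \<in> D. \<exists>d' \<in> D. d \<noteq> d' \<and> \<not> cyclic_pair P z d \<and> \<not> cyclic_pair P z d'"
proof -
  interpret group P using assms by (simp add: maximal_class_2_group_def)
  obtain m where m: "m \<ge> 2" "order P = 2 ^ m" "lower_central P (m - 1) \<noteq> {\<one>\<^bsub>P\<^esub>}" "lower_central P m = {\<one>\<^bsub>P\<^esub>}"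
    and nc: "\<not> cyclic_group P" using assms by (auto simp: maximal_class_2_group_def)
  have "order P > 0" using m(2) by simp
  then have fin: "finite (carrier P)" by (simp add: order_gt_0_iff_finite)
  show ?thesis
  proof (cases "m = 2")
    case True
    then have o4: "order P = 4" using m by simp
    show ?thesis
    proof (rule that[of "carrier P - {\<one>\<^bsub>P\<^esub>}" "{\<one>\<^bsub>P\<^esub>}" "\<one>\<^bsub>P\<^esub>"])
      show "2 * card {\<one>\<^bsub>P\<^esub>} < card (carrier P - {\<one>\<^bsub>P\<^esub>})"
        using o4 fin by (simp add: order_def card_Diff_singleton)
      fix p assume p: "p \<in> carrier P - {\<one>\<^bsub>P\<^esub>}"
      have "generate P {p} \<noteq> carrier P"
      proof
        assume "generate P {p} = carrier P"
        then have "ord p = order P" using generate_pow_card[of p] p by (simp add: order_def)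
        then show False using cyclic_group_of_ord_eq_order[OF fin, of p] nc p by simp
      qed
      moreover have "generate P {p} \<subseteq> carrier P" using p by (intro generate_incl) simp
      ultimately show "order P \<le> 2 * card {q \<in> carrier P. \<not> cyclic_pair P p q}"
        using p noncyclic_order_4_not_cyclic_pair[OF fin o4 nc, of p]
        by (intro card_not_cyclic_pair_ge[OF fin generate_is_subgroup[of "{p}"]]) auto
    qed (use cyclic_pair_one in auto)
  next
    case False
    then have "m = Suc (Suc (Suc (m - 3)))" using m(1) by linarith
    then obtain l where l: "m = Suc (Suc (Suc l))" by (rule that)
    define Z where "Z = centralizer_mod {\<one>\<^bsub>P\<^esub>} (carrier P)"
    have sZ: "subgroup Z P" unfolding Z_def by (intro subgroup_centralizer_mod one_is_normal subset_refl)
    have Z2: "card Z \<le> 2" unfolding Z_def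
      using m l by (intro card_center_maximal_class[OF fin, of l]) (auto simp: numeral_3_eq_3)
    have ZG: "Z \<subseteq> carrier P" by (rule subgroup.subset[OF sZ])
    have finZ: "finite Z" using fin ZG finite_subset by blast
    have oneZ: "\<one>\<^bsub>P\<^esub> \<in> Z" by (rule subgroup.one_closed[OF sZ])
    have "card (Z - {\<one>\<^bsub>P\<^esub>}) \<le> 1" using Z2 oneZ finZ by (simp add: card_Diff_singleton)
    then have eq: "a = b" if "a \<in> Z - {\<one>\<^bsub>P\<^esub>}" "b \<in> Z - {\<one>\<^bsub>P\<^esub>}" for a b
      using card_le_Suc0_iff_eq[of "Z - {\<one>\<^bsub>P\<^esub>}"] finZ that by auto
    obtain z where z: "Z \<subseteq> {\<one>\<^bsub>P\<^esub>, z}"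
    proof (cases "Z \<subseteq> {\<one>\<^bsub>P\<^esub>}")
      case True
      then show ?thesis using that[of "\<one>\<^bsub>P\<^esub>"] by blast
    next
      case False
      then obtain a where "a \<in> Z - {\<one>\<^bsub>P\<^esub>}" by blast
      then show ?thesis using that[of a] eq by blast
    qed
    have comm: "p \<otimes>\<^bsub>P\<^esub> q = q \<otimes>\<^bsub>P\<^esub> p \<longleftrightarrow> p \<otimes>\<^bsub>P\<^esub> q \<otimes>\<^bsub>P\<^esub> inv\<^bsub>P\<^esub> p \<otimes>\<^bsub>P\<^esub> inv\<^bsub>P\<^esub> q = \<one>\<^bsub>P\<^esub>"
      if "p \<in> carrier P" "q \<in> carrier P" for p q
    proof
      assume "p \<otimes>\<^bsub>P\<^esub> q = q \<otimes>\<^bsub>P\<^esub> p"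
      then show "p \<otimes>\<^bsub>P\<^esub> q \<otimes>\<^bsub>P\<^esub> inv\<^bsub>P\<^esub> p \<otimes>\<^bsub>P\<^esub> inv\<^bsub>P\<^esub> q = \<one>\<^bsub>P\<^esub>" using that by (simp add: m_assoc)
    next
      assume *: "p \<otimes>\<^bsub>P\<^esub> q \<otimes>\<^bsub>P\<^esub> inv\<^bsub>P\<^esub> p \<otimes>\<^bsub>P\<^esub> inv\<^bsub>P\<^esub> q = \<one>\<^bsub>P\<^esub>"
      have "p \<otimes>\<^bsub>P\<^esub> q = (p \<otimes>\<^bsub>P\<^esub> q \<otimes>\<^bsub>P\<^esub> inv\<^bsub>P\<^esub> p \<otimes>\<^bsub>P\<^esub> inv\<^bsub>P\<^esub> q) \<otimes>\<^bsub>P\<^esub> (q \<otimes>\<^bsub>P\<^esub> p)"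
        using that by (simp add: m_assoc)
      then show "p \<otimes>\<^bsub>P\<^esub> q = q \<otimes>\<^bsub>P\<^esub> p" unfolding * using that by simp
    qed
    show ?thesis
    proof (rule that[of "carrier P - Z" Z z])
      show "carrier P = carrier P - Z \<union> Z" "(carrier P - Z) \<inter> Z = {}" using ZG by auto
      show "\<one>\<^bsub>P\<^esub> \<in> Z" by (rule oneZ)
      have "card (carrier P - Z) = 2 ^ m - card Z"
        using ZG finZ m(2) by (simp add: card_Diff_subset order_def)
      moreover have "(2::nat) ^ 3 \<le> 2 ^ m" using l by (intro power_increasing) auto
      ultimately show "2 * card Z < card (carrier P - Z)" using Z2 by simp
    next
      fix p assume p: "p \<in> carrier P - Z"
      \<comment> \<open>Elements of a common cyclic subgroup commute, and the centralizer of a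
        noncentral \<open>p\<close> is a proper subgroup.\<close>
      let ?L = "centralizer_mod {\<one>\<^bsub>P\<^esub>} {p}"
      have sL: "subgroup ?L P" using p by (intro subgroup_centralizer_mod one_is_normal) auto
      have Leq: "q \<in> ?L \<longleftrightarrow> q \<otimes>\<^bsub>P\<^esub> p = p \<otimes>\<^bsub>P\<^esub> q" if "q \<in> carrier P" for q
        using that p comm[of q p] by (simp add: centralizer_mod_def)
      obtain g where g: "g \<in> carrier P" "p \<otimes>\<^bsub>P\<^esub> g \<noteq> g \<otimes>\<^bsub>P\<^esub> p"
        using p comm[of p] by (auto simp: Z_def centralizer_mod_def)
      show "order P \<le> 2 * card {q \<in> carrier P. \<not> cyclic_pair P p q}"
      proof (rule card_not_cyclic_pair_ge[OF fin sL])
        have "g \<notin> ?L" using Leq[OF g(1)] g(2) by metis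
        then show "?L \<subset> carrier P" using g(1) subgroup.subset[OF sL] by blast
        show "\<not> cyclic_pair P p q" if "q \<in> carrier P" "q \<notin> ?L" for q
          using that Leq cyclic_pair_commute[of p q] by metis
      qed
    next
      fix b q assume "b \<in> Z" "b \<noteq> z" "q \<in> carrier P"
      then show "cyclic_pair P b q" using z cyclic_pair_one by blast
    next
      fix q assume zZ: "z \<in> Z" and q: "q \<in> carrier P" "\<not> cyclic_pair P z q"
      have zG: "z \<in> carrier P" using zZ ZG by blast
      have z1: "z \<noteq> \<one>\<^bsub>P\<^esub>" using q cyclic_pair_one by blast
      have "cyclic_pair P z z" by (rule cyclic_pair_refl[OF zG])
      then have qZ: "q \<notin> Z" using z q cyclic_pair_sym[OF cyclic_pair_one[OF zG]] by blast
      have "z \<otimes>\<^bsub>P\<^esub> q \<notin> Z"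
      proof
        assume "z \<otimes>\<^bsub>P\<^esub> q \<in> Z"
        then have "inv\<^bsub>P\<^esub> z \<otimes>\<^bsub>P\<^esub> (z \<otimes>\<^bsub>P\<^esub> q) \<in> Z"
          by (rule subgroup.m_closed[OF sZ subgroup.m_inv_closed[OF sZ zZ]])
        then show False using qZ zG q by simp
      qed
      moreover have "\<not> cyclic_pair P z (z \<otimes>\<^bsub>P\<^esub> q)"
        using cyclic_pair_mult_cancel[OF fin _ zG q(1)] q(2) by blast
      moreover have "q \<noteq> z \<otimes>\<^bsub>P\<^esub> q" using z1 zG q(1) by simp
      ultimately show "\<exists>d \<in> carrier P - Z. \<exists>d' \<in> carrier P - Z. d \<noteq> d' \<and> \<not> cyclic_pair P z d \<and> \<not> cyclic_pair P z d'"
        using q qZ zG by (intro bexI[of _ q] bexI[of _ "z \<otimes>\<^bsub>P\<^esub> q"]) auto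
    qed
  qed
qed

section \<open>The direct product\<close>

lemma path_set_subset:
  assumes "finite A" "A \<noteq> {}" "A \<subseteq> D" and D: "\<And>x y. x \<in> D \<Longrightarrow> y \<in> D \<Longrightarrow> R x y"
  shows "path_set R D A"
  using path_set_Un_bad[of A "{}" D R] assms by (simp add: card_gt_0_iff)

theorem theorem3p10:
  fixes n :: nat and P :: "'a monoid" and H :: "'b monoid"
  assumes "n \<ge> 1"
    and "maximal_class_2_group P"
    and "nilpotent_group H" and "finite (carrier H)" and "odd (order H)"
    and "no_cyclic_sylow H"
    and "coprime n (order H)" and "coprime n 2"
  shows "hamiltonian (with_proj (non_cyclic_graph (integer_mod_group n \<times>\<times> P \<times>\<times> H)))"
proof -
  let ?Z = "integer_mod_group n"
  define G where "G = ?Z \<times>\<times> P \<times>\<times> H"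
  have gP: "group P" using assms(2) by (simp add: maximal_class_2_group_def)
  have gH: "group H" using assms(3) by (simp add: nilpotent_group_def)
  have gPH: "group (P \<times>\<times> H)" by (rule DirProd_group[OF gP gH])
  have gG: "group G" unfolding G_def by (rule DirProd_group[OF group_integer_mod_group gPH])
  interpret P: group P by (rule gP)
  interpret H: group H by (rule gH)
  interpret G: group G by (rule gG)
  obtain m where m: "order P = 2 ^ m" using assms(2) by (auto simp: maximal_class_2_group_def)
  then have finP: "finite (carrier P)" using P.order_gt_0_iff_finite by simp
  have carZ: "carrier ?Z = {0..<int n}" using assms(1) by (simp add: carrier_integer_mod_group)
  have ordZ: "order ?Z = n" by (simp add: order_def carZ)
  have carG: "carrier G = carrier ?Z \<times> carrier P \<times> carrier H" by (simp add: G_def)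
  have finG: "finite (carrier G)" using finP assms(4) by (simp add: carG carZ)
  have cop: "coprime (order P) (order H)" using assms(5) by (simp add: m)
  have cop': "coprime (order ?Z) (order (P \<times>\<times> H))"
    using assms(7,8) by (simp add: ordZ order_DirProd m)
  have cycI: "cyclic_pair G (s, p, h) (s', p', h')"
    if "s \<in> carrier ?Z" "s' \<in> carrier ?Z" "cyclic_pair P p p'" "cyclic_pair H h h'" for s s' p p' h h'
    unfolding G_def using that assms(1)
    by (intro cyclic_pair_DirProdI[OF group_integer_mod_group gPH cop'] cyclic_pair_DirProdI[OF gP gH cop]
        cyclic_pair_integer_mod_group) auto
  have cycD: "cyclic_pair P p p'" "cyclic_pair H h h'"
    if "cyclic_pair G (s, p, h) (s', p', h')" for s s' p p' h h'
    using that unfolding G_def by (blast dest: cyclic_pair_DirProdD)+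

  obtain D B z where D: "carrier P = D \<union> B" "D \<inter> B = {}" "\<one>\<^bsub>P\<^esub> \<in> B" "2 * card B < card D"
    "\<And>p. p \<in> D \<Longrightarrow> order P \<le> 2 * card {q \<in> carrier P. \<not> cyclic_pair P p q}"
    "\<And>b q. b \<in> B \<Longrightarrow> b \<noteq> z \<Longrightarrow> q \<in> carrier P \<Longrightarrow> cyclic_pair P b q"
    "\<And>q. z \<in> B \<Longrightarrow> q \<in> carrier P \<Longrightarrow> \<not> cyclic_pair P z q \<Longrightarrow>
      \<exists>d \<in> D. \<exists>d' \<in> D. d \<noteq> d' \<and> \<not> cyclic_pair P z d \<and> \<not> cyclic_pair P z d'"
    by (rule maximal_class_2_group_decomposition[OF assms(2)]) (rule that)
  have DB: "D \<subseteq> carrier P" "B \<subseteq> carrier P" "finite D" "finite B" using D(1) finP by auto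
  have "card B > 0" using D(3) DB by (auto simp: card_gt_0_iff)
  then have D3: "3 \<le> card D" using D(4) by linarith
  obtain f where f: "\<And>h. h \<in> carrier H - {\<one>\<^bsub>H\<^esub>} \<Longrightarrow> f h \<in> carrier H - {\<one>\<^bsub>H\<^esub>}"
    "\<And>h. h \<in> carrier H - {\<one>\<^bsub>H\<^esub>} \<Longrightarrow> \<not> cyclic_pair H h (f h)"
    "\<And>k. card {h \<in> carrier H - {\<one>\<^bsub>H\<^esub>}. f h = k} \<le> 2"
    using nilpotent_noncyclic_partner[OF assms(3-6)] by blast

  define V where "V = carrier G - Cyc G"
  define E where "E x y \<longleftrightarrow> (x, y) \<in> parcs (non_cyclic_graph G)" for x y
  have Cyc: "x \<in> Cyc G \<longleftrightarrow> (\<forall>y \<in> carrier G. cyclic_pair G x y)" if "x \<in> carrier G" for x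
    using that G.cyclic_group_subgroup_generated_iff[OF finG that] by (auto simp: Cyc_def)
  have VI: "x \<in> V" if "x \<in> carrier G" "y \<in> carrier G" "\<not> cyclic_pair G x y" for x y
    using that Cyc[OF that(1)] by (auto simp: V_def)
  have EI: "E x y" if xy: "x \<in> carrier G" "y \<in> carrier G" "\<not> cyclic_pair G x y" for x y
  proof -
    have "cyclic_pair G x x" by (rule G.cyclic_pair_refl[OF xy(1)])
    then have "x \<noteq> y" using xy(3) by blast
    moreover have "\<not> cyclic_pair G y x" using xy(3) cyclic_pair_sym[of G y x] by blast
    then have "x \<in> V" "y \<in> V" using VI[OF xy] VI[OF xy(2,1)] by blast+
    ultimately show ?thesis using G.cyclic_group_subgroup_generated_iff[OF finG xy(1,2)] xy(3)
      by (simp add: E_def non_cyclic_graph_def V_def)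
  qed
  have Esym: "E x y \<longleftrightarrow> E y x" for x y by (auto simp: E_def non_cyclic_graph_def insert_commute)
  have Eirr: "\<not> E x x" for x by (simp add: E_def non_cyclic_graph_def)
  define Gd where "Gd = carrier ?Z \<times> D \<times> carrier H"
  have Gd: "Gd \<subseteq> carrier G" using DB by (auto simp: Gd_def carG)

  \<comment> \<open>The second component alone forces adjacency with at least half of the group; the
    other two components are free.\<close>
  have deg: "card V \<le> 2 * card {y \<in> V. E x y}" if "x \<in> Gd" for x
  proof -
    obtain s p h where x: "x = (s, p, h)" "s \<in> carrier ?Z" "p \<in> D" "h \<in> carrier H"
      using \<open>x \<in> Gd\<close> unfolding Gd_def by blast
    let ?N = "{q \<in> carrier P. \<not> cyclic_pair P p q}"
    have "carrier ?Z \<times> ?N \<times> carrier H \<subseteq> {y \<in> V. E x y}"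
    proof
      fix y assume "y \<in> carrier ?Z \<times> ?N \<times> carrier H"
      then obtain s' q h' where y: "y = (s', q, h')" "s' \<in> carrier ?Z" "q \<in> ?N" "h' \<in> carrier H" by auto
      have nc: "\<not> cyclic_pair G x y" using y(3) cycD(1)[of s p h s' q h'] x(1) y(1) by blast
      have xy: "x \<in> carrier G" "y \<in> carrier G" using x y Gd that by (auto simp: carG)
      have "\<not> cyclic_pair G y x" using nc cyclic_pair_sym[of G y x] by blast
      then show "y \<in> {y \<in> V. E x y}" using EI[OF xy nc] VI[OF xy(2,1)] by blast
    qed
    then have le: "card (carrier ?Z \<times> ?N \<times> carrier H) \<le> card {y \<in> V. E x y}"
      using finG by (intro card_mono) (auto simp: V_def)
    have "card V \<le> card (carrier G)" using finG by (intro card_mono) (auto simp: V_def)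
    also have "\<dots> = n * (order P * order H)"
      by (simp add: carG card_cartesian_product order_def carZ)
    also have "\<dots> \<le> n * ((2 * card ?N) * order H)" using D(5)[OF x(3)] by (intro mult_le_mono) auto
    also have "\<dots> = 2 * card (carrier ?Z \<times> ?N \<times> carrier H)"
      by (simp add: card_cartesian_product order_def carZ)
    finally show ?thesis using le by linarith
  qed

  let ?R = "\<lambda>x y. E x y \<or> x \<in> Gd \<and> y \<in> Gd"
  define bad where "bad k = {h \<in> carrier H - {\<one>\<^bsub>H\<^esub>}. f h = k}" for k
  \<comment> \<open>For trivial third component and second component in \<open>B\<close>, only
    \<open>z\<close> can give a vertex, and it does so iff \<open>z\<close> has a partner in
    \<open>P\<close>. The map \<open>f\<close> does not reach these exceptional vertices.\<close>
  define C where "C k = (if k = \<one>\<^bsub>H\<^esub> \<and> z \<in> B \<and> (\<exists>q \<in> carrier P. \<not> cyclic_pair P z q) then {z} else {})" for k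
  \<comment> \<open>The block of (s, k) is a row over \<open>D\<close>, together with the vertices
    over \<open>B\<close> that \<open>f\<close> sends to \<open>k\<close> and, for trivial
    \<open>k\<close>, the exceptional vertex if there is one.\<close>
  define blk where "blk i = {fst i} \<times> (D \<times> {snd i} \<union> B \<times> bad (snd i) \<union> C (snd i) \<times> {\<one>\<^bsub>H\<^esub>})" for i :: "int \<times> 'b"
  have pathblock: "path_set ?R Gd (blk i)" if "i \<in> carrier ?Z \<times> carrier H" for i
  proof -
    obtain s k where i: "i = (s, k)" "s \<in> carrier ?Z" "k \<in> carrier H" using \<open>i \<in> _\<close> by auto
    let ?A = "{s} \<times> D \<times> {k}"
    have A: "?A \<subseteq> Gd" "finite ?A" using i DB by (auto simp: Gd_def)
    show ?thesis
    proof (cases "C k = {}")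
      case True
      let ?B = "{s} \<times> B \<times> bad k"
      have fb: "finite (bad k)" using assms(4) by (simp add: bad_def)
      \<comment> \<open>Here the fibers of size at most two meet the bound
        \<open>2 * card B < card D\<close>.\<close>
      have "card ?B = card B * card (bad k)" by (simp add: card_cartesian_product)
      also have "\<dots> \<le> card B * 2" using f(3)[of k] by (simp add: bad_def)
      also have "\<dots> < card ?A" using D(4) by (simp add: card_cartesian_product)
      finally have "card ?B < card ?A" .
      moreover have "?A \<inter> ?B = {}" using D(2) by auto
      moreover have "E x y \<and> E y x" if xy: "x \<in> ?A" "y \<in> ?B" for x y
      proof -
        obtain d where x: "x = (s, d, k)" "d \<in> D" using xy by auto
        obtain b h where y: "y = (s, b, h)" "b \<in> B" "h \<in> carrier H - {\<one>\<^bsub>H\<^esub>}" "f h = k"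
          using xy by (auto simp: bad_def)
        have nc: "\<not> cyclic_pair G y x"
          using cycD(2)[of s b h s d k] f(2)[OF y(3)] x(1) y(1,4) by blast
        have "x \<in> carrier G" "y \<in> carrier G" using x y i DB by (auto simp: carG)
        from EI[OF this(2,1) nc] show ?thesis using Esym by blast
      qed
      ultimately have "path_set ?R Gd (?A \<union> ?B)"
        using A fb DB by (intro path_set_Un_bad) auto
      moreover have "blk i = ?A \<union> ?B" using True by (auto simp: blk_def i)
      ultimately show ?thesis by simp
    next
      case False
      then have C: "k = \<one>\<^bsub>H\<^esub>" "z \<in> B" "\<exists>q \<in> carrier P. \<not> cyclic_pair P z q" "C k = {z}"
        by (auto simp: C_def split: if_splits)
      then obtain d d' where d: "d \<in> D" "d' \<in> D" "d \<noteq> d'" "\<not> cyclic_pair P z d" "\<not> cyclic_pair P z d'"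
        using D(7) by blast
      \<comment> \<open>The exceptional vertex is placed between two neighbors from the row. The
        rest of the row is nonempty, as \<open>D\<close> has at least three elements, and forms a
        path of its own.\<close>
      let ?S = "{(s, d, k), (s, z, k), (s, d', k)}"
      have zc: "(s, z, k) \<in> carrier G" "(s, d, k) \<in> carrier G" "(s, d', k) \<in> carrier G"
        using i C d DB by (auto simp: carG)
      have "E (s, z, k) (s, d, k)" "E (s, z, k) (s, d', k)" 
        using EI[OF zc(1,2)] EI[OF zc(1,3)] cycD(1)[of s z k s d k] cycD(1)[of s z k s d' k] d(4,5) by blast+
      moreover have "z \<noteq> d" "z \<noteq> d'" using d C D(2) by auto
      ultimately have "path_set ?R Gd ?S"
        unfolding path_set_def using d i Esym
        by (intro exI[of _ "[(s, d, k), (s, z, k), (s, d', k)]"]) (auto simp: Gd_def)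
      moreover have "path_set ?R Gd (?A - ?S)"
      proof (rule path_set_subset)
        show "?A - ?S \<noteq> {}"
        proof
          assume "?A - ?S = {}"
          then have "D \<subseteq> {d, d'}" using C D(2) by auto
          then have "card D \<le> card {d, d'}" by (intro card_mono) auto
          then show False using D3 d(3) by simp
        qed
      qed (use A in auto)
      moreover have "?S \<inter> (?A - ?S) = {}" by blast
      ultimately have "path_set ?R Gd (?S \<union> (?A - ?S))" by (intro path_set_Un) auto
      moreover have "bad k = {}" using f(1) C(1) by (auto simp: bad_def)
      then have "blk i = ?S \<union> (?A - ?S)" using C d by (auto simp: blk_def i)
      ultimately show ?thesis by simp
    qed
  qed

  have XV: "(\<Union>i \<in> carrier ?Z \<times> carrier H. blk i) = V"
  proof (rule subset_antisym; rule subsetI)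
    fix x assume "x \<in> (\<Union>i \<in> carrier ?Z \<times> carrier H. blk i)"
    then obtain s k where i: "s \<in> carrier ?Z" "k \<in> carrier H" "x \<in> blk (s, k)" by auto
    then consider d where "d \<in> D" "x = (s, d, k)" | b h where "b \<in> B" "h \<in> bad k" "x = (s, b, h)"
      | "z \<in> C k" "x = (s, z, \<one>\<^bsub>H\<^esub>)" by (auto simp: blk_def C_def split: if_splits)
    then show "x \<in> V"
    proof cases
      case (1 d)
      have "order P > 0" by (simp add: m)
      then have "{q \<in> carrier P. \<not> cyclic_pair P d q} \<noteq> {}" using D(5)[OF 1(1)] by (metis card.empty mult_0_right not_le)
      then obtain q where q: "q \<in> carrier P" "\<not> cyclic_pair P d q" by blast
      show ?thesis
        by (rule VI[of _ "(s, q, k)"]) (use 1 q i DB cycD in \<open>auto simp: carG\<close>)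
    next
      case (2 b h)
      then have h: "h \<in> carrier H - {\<one>\<^bsub>H\<^esub>}" by (simp add: bad_def)
      show ?thesis
        by (rule VI[of _ "(s, b, f h)"]) (use 2 h f(1,2)[OF h] i DB cycD in \<open>auto simp: carG\<close>)
    next
      case 3
      then obtain q where q: "z \<in> B" "q \<in> carrier P" "\<not> cyclic_pair P z q" by (auto simp: C_def split: if_splits)
      show ?thesis
        by (rule VI[of _ "(s, q, \<one>\<^bsub>H\<^esub>)"]) (use 3 q i DB cycD in \<open>auto simp: carG\<close>)
    qed
  next
    fix x assume x: "x \<in> V"
    then obtain s p h where sph: "x = (s, p, h)" "s \<in> carrier ?Z" "p \<in> carrier P" "h \<in> carrier H"
      by (auto simp: V_def carG)
    have "x \<in> blk (s, if p \<in> D then h else if h = \<one>\<^bsub>H\<^esub> then \<one>\<^bsub>H\<^esub> else f h)"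
    proof (cases "p \<in> D")
      case False
      then have pB: "p \<in> B" using sph(3) D(1) by blast
      show ?thesis
      proof (cases "h = \<one>\<^bsub>H\<^esub>")
        case True
        \<comment> \<open>With the identity as third component of \<open>x\<close>, noncyclicity can
          only come from \<open>P\<close>, which leaves \<open>p = z\<close>.\<close>
        obtain s' p' h' where y: "s' \<in> carrier ?Z" "p' \<in> carrier P" "h' \<in> carrier H"
          "\<not> cyclic_pair G x (s', p', h')"
          using x Cyc[of x] by (auto simp: V_def carG)
        have "\<not> cyclic_pair P p p'"
          using cycI[OF sph(2) y(1) _ H.cyclic_pair_one[OF y(3)]] y(4) sph(1) True by blast
        then have "p = z" "C \<one>\<^bsub>H\<^esub> = {z}" using D(6)[OF pB _ y(2)] pB y(2) by (auto simp: C_def)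
        then show ?thesis using False True sph by (simp add: blk_def)
      qed (use False pB sph in \<open>simp add: blk_def bad_def\<close>)
    qed (use sph in \<open>simp add: blk_def\<close>)
    moreover have "(if p \<in> D then h else if h = \<one>\<^bsub>H\<^esub> then \<one>\<^bsub>H\<^esub> else f h) \<in> carrier H" using sph f(1) by auto
    ultimately show "x \<in> (\<Union>i \<in> carrier ?Z \<times> carrier H. blk i)" using sph(2) by blast
  qed
  have disj: "blk i \<inter> blk j = {}" if "i \<noteq> j" for i j
    using that D(2) by (cases i; cases j) (auto simp: blk_def bad_def C_def split: if_splits)
  have "path_set ?R Gd (\<Union>i \<in> carrier ?Z \<times> carrier H. blk i)"
    using assms(4) pathblock disj by (intro path_set_UN) (auto simp: carZ)
  then obtain xs where xs: "set xs = V" "distinct xs" "successively ?R xs" "xs \<noteq> [] \<longrightarrow> hd xs \<in> Gd \<and> last xs \<in> Gd"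
    unfolding XV path_set_def by blast
  have finV: "finite V" using finG by (simp add: V_def)
  have V3: "3 \<le> card V"
  proof -
    have "0 \<in> carrier ?Z" by simp
    then have "{0} \<times> D \<times> {\<one>\<^bsub>H\<^esub>} \<subseteq> V" unfolding XV[symmetric] blk_def by force
    then have "card ({0 :: int} \<times> D \<times> {\<one>\<^bsub>H\<^esub>}) \<le> card V" using finV by (intro card_mono)
    then show ?thesis using D3 by (simp add: card_cartesian_product)
  qed
  then have "xs \<noteq> []" using xs(1) by auto
  \<comment> \<open>The closing pair of \<open>xs\<close> need not be an edge, but both of its ends
    are in \<open>Gd\<close>, as the closure lemma requires.\<close>
  then obtain ys where ys: "set ys = V" "distinct ys" "ys \<noteq> []" "successively E ys" "E (last ys) (hd ys)"
    using hamilton_cycle_closure[OF finV Esym Eirr deg xs(1,2) _ xs(3)] xs(4) by blast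
  have "hamiltonian (with_proj (non_cyclic_graph G))"
  proof (rule hamiltonianI)
    show "set ys = pverts (non_cyclic_graph G)" using ys(1) by (simp add: non_cyclic_graph_def V_def)
    show "3 \<le> length ys" using V3 ys(1,2) by (metis distinct_card)
    show "successively (\<lambda>x y. (x, y) \<in> parcs (non_cyclic_graph G)) ys"
      "(last ys, hd ys) \<in> parcs (non_cyclic_graph G)" using ys by (simp_all add: E_def)
  qed (rule ys(2))
  then show ?thesis by (simp add: G_def)
qed

end
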